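(* Given a deterministic $\mathsf{Sup}$-automaton $\mathcal{A}$ over an alphabet $\Sigma$, one can construct in polynomial time a deterministic safe $\mathsf{Inf}$-automaton $\mathcal{B}$ and a deterministic live $\mathsf{Sup}$-automaton $\mathcal{C}$ such that $\mathcal{A}(w) = \min(\mathcal{B}(w), \mathcal{C}(w))$ for every infinite word $w \in \Sigma^\omega$.
   Context: $u \prec w$ means that the finite word $u$ is a strict prefix of $w$ (possibly empty). A quantitative automaton is a tuple $\mathcal{A} = (\Sigma, Q, \iota, \delta)$ with a finite alphabet $\Sigma$, a finite nonempty set $Q$ of states, an initial state $\iota \in Q$, and a transition function $\delta : Q \times \Sigma \to 2^{\mathbb{Q} \times Q}$ with finite nonempty values. It is deterministic if every $\delta(q,\sigma)$ is a singleton. A run on $w = w[0]w[1]\ldots \in \Sigma^\omega$ is a sequence of transitions $(q_i, w[i], x_i, q_{i+1})_{i \geq 0}$ with $q_0 = \iota$ and $(x_i, q_{i+1}) \in \delta(q_i, w[i])$; it yields the weight sequence $x_0 x_1 \ldots$. In a $\mathsf{Val}$-automaton the value of a run is $\mathsf{Val}$ of its weight sequence, and $\mathcal{A}(w)$ is the supremum of the values of all runs of $\mathcal{A}$ on $w$ (so the value of the unique run if $\mathcal{A}$ is deterministic). Here $\mathsf{Inf}(v) = \inf_n v_n$ and $\mathsf{Sup}(v) = \sup_n v_n$. The size of an automaton is the maximum of the sizes of its alphabet, state space and transition space, with weights represented in binary. An automaton $\mathcal{A}$ is safe when for every $w \in \Sigma^\omega$ and $v \in \mathbb{R}$ with $\mathcal{A}(w)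 < v$ there is $u \prec w$ with $\sup_{w' \in \Sigma^\omega} \mathcal{A}(uw') < v$. With $\top_{\mathcal{A}} = \sup_{w \in \Sigma^\omega} \mathcal{A}(w)$, an automaton $\mathcal{A}$ is live when for all $w \in \Sigma^\omega$ with $\mathcal{A}(w) < \top_{\mathcal{A}}$ there exists $v \in \mathbb{R}$ with $\mathcal{A}(w) < v$ such that for all $u \prec w$ we have $\sup_{w' \in \Sigma^\omega} \mathcal{A}(uw') \geq v$. *)

theory Defs
  imports Complex_Main "HOL-Library.Omega_Words_Fun" "HOL-Computational_Algebra.Polynomial"
begin

section \<open>Quantitative automata\<close>

record ('a, 'q) automaton =
  alphabet :: "'a set"
  states :: "'q set"
  initial :: 'q
  delta :: "'q \<Rightarrow> 'a \<Rightarrow> (rat \<times> 'q) set"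

text \<open>The values of \<open>delta\<close> outside \<open>states \<times> alphabet\<close> are irrelevant.\<close>

definition quantitative_automaton :: "('a, 'q) automaton \<Rightarrow> bool" where
  "quantitative_automaton A \<longleftrightarrow>
     finite (alphabet A) \<and> finite (states A) \<and> initial A \<in> states A \<and>
     (\<forall>q\<in>states A. \<forall>a\<in>alphabet A.
        finite (delta A q a) \<and> delta A q a \<noteq> {} \<and> delta A q a \<subseteq> UNIV \<times> states A)"

definition deterministic :: "('a, 'q) automaton \<Rightarrow> bool" where
  "deterministic A \<longleftrightarrow> (\<forall>q\<in>states A. \<forall>a\<in>alphabet A. is_singleton (delta A q a))"

definition transitions :: "('a, 'q) automaton \<Rightarrow> ('q \<times> 'a \<times> rat \<times> 'q) set" where
  "transitions A =
     {(q, a, x, q'). q \<in> states A \<and> a \<in> alphabet A \<and> (x, q') \<in> delta A q a}"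

definition omega_words :: "'a set \<Rightarrow> 'a word set" where
  "omega_words \<Sigma> = {w. range w \<subseteq> \<Sigma>}"

definition strict_prefix_of :: "'a list \<Rightarrow> 'a word \<Rightarrow> bool"  (infix "\<prec>" 50) where
  "u \<prec> w \<longleftrightarrow> (\<exists>n. u = prefix n w)"

text \<open>The run made of the transitions \<open>(qs i, w i, xs i, qs (Suc i))\<close> is given by
  its state sequence \<open>qs\<close> and its weight sequence \<open>xs\<close>.\<close>

definition is_run :: "('a, 'q) automaton \<Rightarrow> 'a word \<Rightarrow> (nat \<Rightarrow> 'q) \<Rightarrow> (nat \<Rightarrow> rat) \<Rightarrow> bool" where
  "is_run A w qs xs \<longleftrightarrow>
     qs 0 = initial A \<and> (\<forall>i. (xs i, qs (Suc i)) \<in> delta A (qs i) (w i))"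

type_synonym val_fun = "(nat \<Rightarrow> real) \<Rightarrow> real"

definition Inf_val :: val_fun where
  "Inf_val v = (INF n. v n)"

definition Sup_val :: val_fun where
  "Sup_val v = (SUP n. v n)"

text \<open>The value of a word in the \<open>Val\<close>-automaton \<open>A\<close>. Suprema and infima are taken in
  \<open>real\<close>: an automaton has finitely many weights and every state has a successor for each
  letter, so for \<open>Inf_val\<close> and \<open>Sup_val\<close>, and for words over a (nonempty) alphabet, all
  the sets involved here and below are nonempty and bounded.\<close>

definition aut_value :: "val_fun \<Rightarrow> ('a, 'q) automaton \<Rightarrow> 'a word \<Rightarrow> real" where
  "aut_value Val A w = Sup {Val (\<lambda>i. of_rat (xs i)) | qs xs. is_run A w qs xs}"

definition top_value :: "val_fun \<Rightarrow> ('a, 'q) automaton \<Rightarrow> real" where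
  "top_value Val A = (SUP w\<in>omega_words (alphabet A). aut_value Val A w)"

definition safe :: "val_fun \<Rightarrow> ('a, 'q) automaton \<Rightarrow> bool" where
  "safe Val A \<longleftrightarrow>
     (\<forall>w\<in>omega_words (alphabet A). \<forall>v. aut_value Val A w < v \<longrightarrow>
        (\<exists>u. u \<prec> w \<and> (SUP w'\<in>omega_words (alphabet A). aut_value Val A (u \<frown> w')) < v))"

definition live :: "val_fun \<Rightarrow> ('a, 'q) automaton \<Rightarrow> bool" where
  "live Val A \<longleftrightarrow>
     (\<forall>w\<in>omega_words (alphabet A). aut_value Val A w < top_value Val A \<longrightarrow>
        (\<exists>v. aut_value Val A w < v \<and>
           (\<forall>u. u \<prec> w \<longrightarrow> (SUP w'\<in>omega_words (alphabet A). aut_value Val A (u \<frown> w')) \<ge> v)))"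


section \<open>Size of an automaton\<close>

fun nat_bits :: "nat \<Rightarrow> bool list" where
  "nat_bits n = (if n = 0 then [] else odd n # nat_bits (n div 2))"

declare nat_bits.simps [simp del]

definition rat_bitlen :: "rat \<Rightarrow> nat" where
  "rat_bitlen x =
     (case quotient_of x of (n, d) \<Rightarrow>
        length (nat_bits (nat \<bar>n\<bar>)) + length (nat_bits (nat d)))"

definition aut_size :: "('a, 'q) automaton \<Rightarrow> nat" where
  "aut_size A =
     Max {card (alphabet A), card (states A),
          (\<Sum>(q, a, x, q')\<in>transitions A. 1 + rat_bitlen x)}"


section \<open>Model of computation\<close>

text \<open>
  Polynomial time is measured in a first-order functional language over binary trees (pure
  LISP). A program is a list of function bodies, function 0 being the entry point; variables
  are de Bruijn indices into the environment, and the body of a function is evaluated in the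
  environment of its arguments.

  In \<open>eval P \<rho> e v t\<close>, \<open>v\<close> is the result and \<open>t\<close> the cost. Every evaluation rule costs one
  unit, and reading a variable costs in addition the number of nodes of the tree that is
  copied, so that no large tree can be built cheaply by sharing: every value occurring in an
  evaluation has fewer nodes than the cost (\<open>eval_size_less\<close>). There is no arithmetic and no
  equality primitive. Hence evaluation and Turing machines simulate each other with
  polynomial overhead.
\<close>

datatype tree = Leaf | Node tree tree

datatype expr =
    Var nat
  | LeafE
  | NodeE expr expr
  | Left expr
  | Right expr
  | If expr expr expr
  | LetE expr expr
  | Call nat "expr list"

type_synonym prog = "expr list"

fun left :: "tree \<Rightarrow> tree" where
  "left Leaf = Leaf"
| "left (Node l r) = l"

fun right :: "tree \<Rightarrow> tree" where
  "right Leaf = Leaf"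
| "right (Node l r) = r"

inductive eval :: "prog \<Rightarrow> tree list \<Rightarrow> expr \<Rightarrow> tree \<Rightarrow> nat \<Rightarrow> bool"
  and evals :: "prog \<Rightarrow> tree list \<Rightarrow> expr list \<Rightarrow> tree list \<Rightarrow> nat \<Rightarrow> bool"
  for P :: prog
where
  eval_Var: "i < length \<rho> \<Longrightarrow> eval P \<rho> (Var i) (\<rho> ! i) (1 + size (\<rho> ! i))"
| eval_Leaf: "eval P \<rho> LeafE Leaf 1"
| eval_Node: "eval P \<rho> e\<^sub>1 v\<^sub>1 t\<^sub>1 \<Longrightarrow> eval P \<rho> e\<^sub>2 v\<^sub>2 t\<^sub>2 \<Longrightarrow>
    eval P \<rho> (NodeE e\<^sub>1 e\<^sub>2) (Node v\<^sub>1 v\<^sub>2) (1 + t\<^sub>1 + t\<^sub>2)"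
| eval_Left: "eval P \<rho> e v t \<Longrightarrow> eval P \<rho> (Left e) (left v) (1 + t)"
| eval_Right: "eval P \<rho> e v t \<Longrightarrow> eval P \<rho> (Right e) (right v) (1 + t)"
| eval_If_True: "eval P \<rho> c u s \<Longrightarrow> u \<noteq> Leaf \<Longrightarrow> eval P \<rho> e\<^sub>1 v t \<Longrightarrow>
    eval P \<rho> (If c e\<^sub>1 e\<^sub>2) v (1 + s + t)"
| eval_If_False: "eval P \<rho> c Leaf s \<Longrightarrow> eval P \<rho> e\<^sub>2 v t \<Longrightarrow>
    eval P \<rho> (If c e\<^sub>1 e\<^sub>2) v (1 + s + t)"
| eval_Let: "eval P \<rho> e\<^sub>1 u s \<Longrightarrow> eval P (u # \<rho>) e\<^sub>2 v t \<Longrightarrow>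
    eval P \<rho> (LetE e\<^sub>1 e\<^sub>2) v (1 + s + t)"
| eval_Call: "evals P \<rho> es vs s \<Longrightarrow> i < length P \<Longrightarrow> eval P vs (P ! i) v t \<Longrightarrow>
    eval P \<rho> (Call i es) v (1 + s + t)"
| evals_Nil: "evals P \<rho> [] [] 0"
| evals_Cons: "eval P \<rho> e v s \<Longrightarrow> evals P \<rho> es vs t \<Longrightarrow>
    evals P \<rho> (e # es) (v # vs) (s + t)"

definition computes_in :: "prog \<Rightarrow> tree \<Rightarrow> tree \<Rightarrow> nat \<Rightarrow> bool" where
  "computes_in P x y t \<longleftrightarrow> P \<noteq> [] \<and> eval P [x] (P ! 0) y t"

lemma eval_size_less:
  "eval P \<rho> e v t \<Longrightarrow> size v < t"
  "evals P \<rho> es vs t \<Longrightarrow> sum_list (map size vs) \<le> t"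
proof (induction rule: eval_evals.inducts)
  case (eval_Left \<rho> e v t)
  then show ?case by (cases v) auto
next
  case (eval_Right \<rho> e v t)
  then show ?case by (cases v) auto
qed auto

lemma eval_deterministic:
  "eval P \<rho> e v t \<Longrightarrow> eval P \<rho> e v' t' \<Longrightarrow> v' = v \<and> t' = t"
  "evals P \<rho> es vs t \<Longrightarrow> evals P \<rho> es vs' t' \<Longrightarrow> vs' = vs \<and> t' = t"
proof (induction arbitrary: v' t' and vs' t' rule: eval_evals.inducts)
  case (eval_Var i \<rho>)
  then show ?case by (auto elim: eval.cases)
next
  case (eval_Leaf \<rho>)
  then show ?case by (auto elim: eval.cases)
next
  case (eval_Node \<rho> e\<^sub>1 v\<^sub>1 t\<^sub>1 e\<^sub>2 v\<^sub>2 t\<^sub>2)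
  from eval_Node.prems show ?case by cases (use eval_Node.IH in blast)
next
  case (eval_Left \<rho> e v t)
  from eval_Left.prems show ?case by cases (use eval_Left.IH in blast)
next
  case (eval_Right \<rho> e v t)
  from eval_Right.prems show ?case by cases (use eval_Right.IH in blast)
next
  case (eval_If_True \<rho> c u s e\<^sub>1 v t e\<^sub>2)
  from eval_If_True.prems show ?case by cases (use eval_If_True in blast)+
next
  case (eval_If_False \<rho> c s e\<^sub>2 v t e\<^sub>1)
  from eval_If_False.prems show ?case by cases (use eval_If_False in blast)+
next
  case (eval_Let \<rho> e\<^sub>1 u s e\<^sub>2 v t)
  from eval_Let.prems show ?case by cases (use eval_Let.IH in blast)
next
  case (eval_Call \<rho> es vs s i v t)
  from eval_Call.prems show ?case by cases (use eval_Call.IH in blast)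
next
  case (evals_Nil \<rho>)
  then show ?case by (auto elim: evals.cases)
next
  case (evals_Cons \<rho> e v s es vs t)
  from evals_Cons.prems show ?case by cases (use evals_Cons.IH in blast)
qed


section \<open>Representation of automata as trees\<close>

definition enc_bool :: "bool \<Rightarrow> tree" where
  "enc_bool b = (if b then Node Leaf Leaf else Leaf)"

definition enc_list :: "('b \<Rightarrow> tree) \<Rightarrow> 'b list \<Rightarrow> tree" where
  "enc_list enc xs = foldr (\<lambda>x. Node (enc x)) xs Leaf"

definition enc_nat :: "nat \<Rightarrow> tree" where
  "enc_nat n = enc_list enc_bool (nat_bits n)"

definition enc_int :: "int \<Rightarrow> tree" where
  "enc_int i = Node (enc_bool (i < 0)) (enc_nat (nat \<bar>i\<bar>))"

definition enc_rat :: "rat \<Rightarrow> tree" where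
  "enc_rat x = (case quotient_of x of (n, d) \<Rightarrow> Node (enc_int n) (enc_nat (nat d)))"

definition enc_trans :: "('a \<Rightarrow> nat) \<Rightarrow> ('q \<Rightarrow> nat) \<Rightarrow> 'q \<times> 'a \<times> rat \<times> 'q \<Rightarrow> tree" where
  "enc_trans f g = (\<lambda>(q, a, x, q').
     Node (enc_nat (g q)) (Node (enc_nat (f a)) (Node (enc_rat x) (enc_nat (g q')))))"

text \<open>The tree \<open>z\<close> represents \<open>A\<close>, where \<open>f\<close> numbers the letters by
  \<open>0, \<dots>, card (alphabet A) - 1\<close>: for some numbering of the states, \<open>z\<close> lists the letters,
  the states, the initial state, and the transitions in some order without repetition. All
  numbers are in binary.\<close>

definition represents :: "('a \<Rightarrow> nat) \<Rightarrow> tree \<Rightarrow> ('a, 'q) automaton \<Rightarrow> bool" where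
  "represents f z A \<longleftrightarrow>
     bij_betw f (alphabet A) {..<card (alphabet A)} \<and>
     (\<exists>g ts. bij_betw g (states A) {..<card (states A)} \<and>
        distinct ts \<and> set ts = transitions A \<and>
        z = Node (enc_list enc_nat [0..<card (alphabet A)])
              (Node (enc_list enc_nat [0..<card (states A)])
                (Node (enc_nat (g (initial A)))
                  (enc_list (enc_trans f g) ts))))"

end

theory Submission
  imports Defs
begin

text \<open>
  Track the greatest weight \<open>m\<close> seen so far, and let \<open>top q\<close> be the greatest weight on a transition
  reachable from the state \<open>q\<close>. The safety closure of \<open>A\<close> has the value \<open>max m (top q)\<close> after a
  prefix, so \<open>B\<close> outputs this weight after every step. The automaton \<open>C\<close> outputs the weights of
  \<open>A\<close>, except that it outputs the greatest weight \<open>W\<close> of \<open>A\<close> as soon as \<open>m \<ge> top q\<close>. If that happens,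
  then \<open>B\<close> and \<open>A\<close> have the same value and \<open>C\<close> has the value \<open>W\<close>; otherwise \<open>C\<close> and \<open>A\<close> have
  the same value, which is at most that of \<open>B\<close>. After any prefix one can still take a weight
  \<open>top q\<close>, after which \<open>m \<ge> top q'\<close>, so \<open>C\<close> is live; deterministic \<open>Inf\<close>-automata are always safe.

  In the states of \<open>B\<close> and \<open>C\<close> the weight \<open>m\<close> is represented by its rank, the number of transitions of
  weight at most \<open>m\<close>. The program exists because the polynomial-time functions are closed
  under composition and under iteration over a list with polynomially bounded accumulators.
\<close>

section \<open>Polynomial-time functions on trees\<close>

text \<open>After a prefix with \<open>m \<ge> top q\<close> the value of \<open>A\<close> is
  decided. Since there are only finitely many weights, a word below the top value of
  \<open>A\<close> violates liveness precisely if some prefix of it leads to this situation: the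
  best continuation then has the value of the word itself. Such words have to be lifted by
  \<open>C\<close>, and they can be lifted all the way to \<open>W\<close> because \<open>B\<close>
  already pins down their value.

  The states of \<open>B\<close> and \<open>C\<close> have to remember \<open>m\<close> and still
  form an initial segment of the naturals of polynomial length. Weights in binary range over too
  many values for that, whereas ranks are bounded by the number of transitions.

  Polynomial time is a claim about one explicit program for all automata. Instead of writing it out,
  the construction is defined on lists and numbers, and closure rules that link programs show each
  of its functions to be polynomial. The rule for loops has to control the sizes of intermediate
  values; the instance set \<open>S\<close> carries the invariants needed for this.\<close>

lemma poly_nat_mono: "m \<le> n \<Longrightarrow> poly p m \<le> poly p n" for p :: "nat poly"
  by (induction p) (auto intro!: mult_mono add_mono)

definition env :: "('x \<Rightarrow> tree) list \<Rightarrow> 'x \<Rightarrow> tree list" where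
  "env E x = map (\<lambda>f. f x) E"

definition env_size :: "('x \<Rightarrow> tree) list \<Rightarrow> 'x \<Rightarrow> nat" where
  "env_size E x = sum_list (map (\<lambda>f. size (f x)) E)"

definition polybdd :: "'x set \<Rightarrow> ('x \<Rightarrow> tree) list \<Rightarrow> ('x \<Rightarrow> nat) \<Rightarrow> bool" where
  "polybdd S E h \<longleftrightarrow> (\<exists>p. \<forall>x\<in>S. h x \<le> poly p (env_size E x))"

text \<open>\<open>polytime S E G\<close>: uniformly in the instance \<open>x \<in> S\<close>, the tree \<open>G x\<close> is computed from the
  variables \<open>env E x\<close> in time polynomial in their total size.\<close>

definition polytime :: "'x set \<Rightarrow> ('x \<Rightarrow> tree) list \<Rightarrow> ('x \<Rightarrow> tree) \<Rightarrow> bool" where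
  "polytime S E G \<longleftrightarrow>
     (\<exists>P e T. polybdd S E T \<and> (\<forall>x\<in>S. \<exists>t\<le>T x. eval P (env E x) e (G x) t))"

lemma polytimeI:
  assumes "polybdd S E T" "\<And>x. x \<in> S \<Longrightarrow> \<exists>t\<le>T x. eval P (env E x) e (G x) t"
  shows "polytime S E G"
  unfolding polytime_def
  by (rule exI [of _ P], rule exI [of _ e], rule exI [of _ T]) (use assms in auto)

lemma polytimeE:
  assumes "polytime S E G"
  obtains P e T where "polybdd S E T" "\<And>x. x \<in> S \<Longrightarrow> \<exists>t\<le>T x. eval P (env E x) e (G x) t"
  using assms unfolding polytime_def by (elim exE conjE) (rule that, auto)

lemma env_simps [simp]:
  "env [] x = []" "env (f # E) x = f x # env E x" "length (env E x) = length E"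
  by (auto simp: env_def)

lemma env_size_simps [simp]:
  "env_size [] x = 0" "env_size (f # E) x = size (f x) + env_size E x"
  by (auto simp: env_size_def)

lemma sum_list_size_env: "sum_list (map size (env E x)) = env_size E x"
  by (simp add: env_def env_size_def comp_def)

lemma size_le_env_size: "G \<in> set E \<Longrightarrow> size (G x) \<le> env_size E x"
  by (induction E) auto

lemma polybddI: "(\<And>x. x \<in> S \<Longrightarrow> h x \<le> poly p (env_size E x)) \<Longrightarrow> polybdd S E h"
  by (auto simp: polybdd_def)

lemma polybdd_mono: "polybdd S E h \<Longrightarrow> (\<And>x. x \<in> S \<Longrightarrow> h' x \<le> h x) \<Longrightarrow> polybdd S E h'"
  unfolding polybdd_def by (elim exE) (blast intro: order_trans)

lemma polybdd_const: "polybdd S E (\<lambda>_. c)"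
  by (rule polybddI [where p = "[:c:]"]) simp

lemma polybdd_env_size: "polybdd S E (env_size E)"
  by (rule polybddI [where p = "[:0, 1:]"]) simp

lemma polybdd_add: "polybdd S E h \<Longrightarrow> polybdd S E h' \<Longrightarrow> polybdd S E (\<lambda>x. h x + h' x)"
  unfolding polybdd_def
proof (elim exE)
  fix p q assume "\<forall>x\<in>S. h x \<le> poly p (env_size E x)" "\<forall>x\<in>S. h' x \<le> poly q (env_size E x)"
  then show "\<exists>p. \<forall>x\<in>S. h x + h' x \<le> poly p (env_size E x)"
    by (intro exI [of _ "p + q"]) (auto intro: add_mono)
qed

lemma polybdd_mult: "polybdd S E h \<Longrightarrow> polybdd S E h' \<Longrightarrow> polybdd S E (\<lambda>x. h x * h' x)"
  unfolding polybdd_def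
proof (elim exE)
  fix p q assume "\<forall>x\<in>S. h x \<le> poly p (env_size E x)" "\<forall>x\<in>S. h' x \<le> poly q (env_size E x)"
  then show "\<exists>p. \<forall>x\<in>S. h x * h' x \<le> poly p (env_size E x)"
    by (intro exI [of _ "p * q"]) (auto intro: mult_mono)
qed

lemma polybdd_poly: "polybdd S E h \<Longrightarrow> polybdd S E (\<lambda>x. poly p (h x))"
  unfolding polybdd_def
proof (elim exE)
  fix q assume q: "\<forall>x\<in>S. h x \<le> poly q (env_size E x)"
  then show "\<exists>q. \<forall>x\<in>S. poly p (h x) \<le> poly q (env_size E x)"
    by (intro exI [of _ "pcompose p q"]) (auto simp: poly_pcompose intro: poly_nat_mono)
qed

lemma polybdd_Suc: "polybdd S E h \<Longrightarrow> polybdd S E (\<lambda>x. Suc (h x))"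
  using polybdd_add [OF polybdd_const [of S E 1]] by simp

lemmas polybdd_intros =
  polybdd_const polybdd_env_size polybdd_add polybdd_mult polybdd_poly polybdd_Suc

text \<open>A result has fewer nodes than the cost of computing it, so every time bound is also a
  size bound. The rules for loops take their size bounds from here.\<close>

lemma polytime_size: "polytime S E G \<Longrightarrow> polybdd S E (\<lambda>x. size (G x))"
  unfolding polytime_def
  by (elim exE conjE, erule polybdd_mono) (auto dest!: bspec eval_size_less(1))

lemma polytime_cong:
  "polytime S E G \<Longrightarrow> (\<And>x. x \<in> S \<Longrightarrow> G' x = G x) \<Longrightarrow> polytime S E G'"
  unfolding polytime_def by (elim exE conjE, intro exI conjI) auto

lemma polytime_subset: "polytime S E G \<Longrightarrow> S' \<subseteq> S \<Longrightarrow> polytime S' E G"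
proof -
  assume "polytime S E G" "S' \<subseteq> S"
  then obtain P e T where "polybdd S E T" "\<And>x. x \<in> S \<Longrightarrow> \<exists>t\<le>T x. eval P (env E x) e (G x) t"
    by (elim polytimeE) (rule that)
  moreover have "polybdd S' E T"
    using \<open>S' \<subseteq> S\<close> \<open>polybdd S E T\<close> unfolding polybdd_def by blast
  ultimately show "polytime S' E G" using \<open>S' \<subseteq> S\<close> by (intro polytimeI) auto
qed

text \<open>A program sees the environment but not the instance, so it can be reused along any map
  of instances.\<close>

lemma polytime_reindex:
  assumes "polytime S E G" "\<And>y. y \<in> S' \<Longrightarrow> h y \<in> S"
  shows "polytime S' (map (\<lambda>f y. f (h y)) E) (\<lambda>y. G (h y))"
proof -
  from assms(1) obtain P e T p where p: "\<forall>x\<in>S. T x \<le> poly p (env_size E x)"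
    and ev: "\<forall>x\<in>S. \<exists>t\<le>T x. eval P (env E x) e (G x) t"
    by (auto simp: polytime_def polybdd_def)
  have *: "env (map (\<lambda>f y. f (h y)) E) y = env E (h y)"
    "env_size (map (\<lambda>f y. f (h y)) E) y = env_size E (h y)" for y
    by (auto simp: env_def env_size_def comp_def)
  show ?thesis unfolding polytime_def
    by (intro exI [of _ P] exI [of _ e] exI [of _ "\<lambda>y. T (h y)"] conjI polybddI [where p = p])
      (use p ev assms(2) in \<open>auto simp: *\<close>)
qed

section \<open>Linking programs\<close>

text \<open>Relocates the calls of a program that is placed behind \<open>n\<close> other functions.
  Variables keep their indices, since linking does not change any environment.\<close>

primrec shift :: "nat \<Rightarrow> expr \<Rightarrow> expr" where
  "shift n (Var i) = Var i"
| "shift n LeafE = LeafE"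
| "shift n (NodeE a b) = NodeE (shift n a) (shift n b)"
| "shift n (Left a) = Left (shift n a)"
| "shift n (Right a) = Right (shift n a)"
| "shift n (If c a b) = If (shift n c) (shift n a) (shift n b)"
| "shift n (LetE a b) = LetE (shift n a) (shift n b)"
| "shift n (Call i es) = Call (i + n) (map (shift n) es)"

lemma shift_0: "shift 0 e = e"
  by (induction e) (auto intro: map_idI)

text \<open>The simplified copies match goals in which \<open>1 + t\<close> has become
  \<open>Suc t\<close>.\<close>

lemmas eval_intros = eval_evals.intros eval_evals.intros [simplified]

text \<open>It suffices that \<open>P\<close> contains the shifted copy of \<open>Q\<close> at
  offset \<open>n\<close>. Offset 0 covers extension at the end, offset \<open>length P\<close>
  linking behind another program, and offset 1 an entry point put in front.\<close>

lemma eval_shift: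
  "eval Q \<rho> e v t \<Longrightarrow> (\<And>i. i < length Q \<Longrightarrow> i + n < length P \<and> P ! (i + n) = shift n (Q ! i)) \<Longrightarrow>
     eval P \<rho> (shift n e) v t"
  "evals Q \<rho> es vs t \<Longrightarrow> (\<And>i. i < length Q \<Longrightarrow> i + n < length P \<and> P ! (i + n) = shift n (Q ! i)) \<Longrightarrow>
     evals P \<rho> (map (shift n) es) vs t"
proof (induction rule: eval_evals.inducts)
  case (eval_Call \<rho> es vs s i v t)
  then have "eval P vs (P ! (i + n)) v t" "i + n < length P" by auto
  then show ?case using eval_evals.eval_Call [of P \<rho> "map (shift n) es" vs s "i + n" v t] eval_Call
    by simp
qed (auto intro: eval_intros)

lemma eval_append: "eval P \<rho> e v t \<Longrightarrow> eval (P @ Q) \<rho> e v t"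
  and evals_append: "evals P \<rho> es vs t \<Longrightarrow> evals (P @ Q) \<rho> es vs t"
proof -
  have *: "map (shift 0) es = es" by (simp add: shift_0 map_idI)
  have **: "i + 0 < length (P @ Q) \<and> (P @ Q) ! (i + 0) = shift 0 (P ! i)" if "i < length P" for i
    using that by (simp add: shift_0 nth_append)
  show "eval P \<rho> e v t \<Longrightarrow> eval (P @ Q) \<rho> e v t" "evals P \<rho> es vs t \<Longrightarrow> evals (P @ Q) \<rho> es vs t"
    using eval_shift(1) [OF _ **, of \<rho> e v t] eval_shift(2) [OF _ **, of \<rho> es vs t]
    by (simp_all add: shift_0 *)
qed

lemma eval_prepend:
    "eval Q \<rho> e v t \<Longrightarrow> eval (P @ map (shift (length P)) Q) \<rho> (shift (length P) e) v t"
  and evals_prepend: "evals Q \<rho> es vs t \<Longrightarrow>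
    evals (P @ map (shift (length P)) Q) \<rho> (map (shift (length P)) es) vs t"
  by (rule eval_shift; auto simp: nth_append)+

text \<open>A function body sees only its arguments, so a recursive call has to pass the whole
  environment on. The part \<open>\<sigma>\<close> holds the variables in front that are
  skipped.\<close>

lemma evals_map_Var:
  "evals P (\<sigma> @ \<rho>) (map Var [length \<sigma>..<length \<sigma> + length \<rho>]) \<rho> (length \<rho> + sum_list (map size \<rho>))"
proof (induction \<rho> arbitrary: \<sigma>)
  case Nil
  then show ?case by (auto intro: eval_intros)
next
  case (Cons v \<rho>)
  have "eval P (\<sigma> @ v # \<rho>) (Var (length \<sigma>)) v (1 + size v)"
    using eval_Var [of "length \<sigma>" "\<sigma> @ v # \<rho>" P] by simp
  moreover have "evals P (\<sigma> @ v # \<rho>) (map Var [Suc (length \<sigma>)..<length \<sigma> + length (v # \<rho>)]) \<rho>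
      (length \<rho> + sum_list (map size \<rho>))"
    using Cons [of "\<sigma> @ [v]"] by simp
  ultimately have "evals P (\<sigma> @ v # \<rho>)
      (Var (length \<sigma>) # map Var [Suc (length \<sigma>)..<length \<sigma> + length (v # \<rho>)]) (v # \<rho>)
      (1 + size v + (length \<rho> + sum_list (map size \<rho>)))"
    by (rule evals_Cons)
  moreover have "[length \<sigma>..<length \<sigma> + length (v # \<rho>)] =
      length \<sigma> # [Suc (length \<sigma>)..<length \<sigma> + length (v # \<rho>)]"
    by (simp add: upt_conv_Cons del: upt_Suc)
  moreover have "1 + size v + (length \<rho> + sum_list (map size \<rho>)) =
      length (v # \<rho>) + sum_list (map size (v # \<rho>))"
    by simp
  ultimately show ?case by (simp only: list.map)
qed

section \<open>Closure properties of polynomial time\<close>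

text \<open>Linking the two programs yields a common one, which the closure rules with two premises
  start from. The two instance sets may differ because the branches of a conditional do.\<close>

lemma polytimeE2:
  assumes "polytime S E G" "polytime S' E' G'"
  obtains P e e' T T' where "polybdd S E T" "polybdd S' E' T'"
    "\<And>x. x \<in> S \<Longrightarrow> \<exists>t\<le>T x. eval P (env E x) e (G x) t"
    "\<And>x. x \<in> S' \<Longrightarrow> \<exists>t\<le>T' x. eval P (env E' x) e' (G' x) t"
proof -
  obtain P e T where 1: "polybdd S E T" "\<And>x. x \<in> S \<Longrightarrow> \<exists>t\<le>T x. eval P (env E x) e (G x) t"
    using assms(1) by (rule polytimeE) (rule that)
  obtain Q e' T' where 2: "polybdd S' E' T'" "\<And>x. x \<in> S' \<Longrightarrow> \<exists>t\<le>T' x. eval Q (env E' x) e' (G' x) t"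
    using assms(2) by (rule polytimeE) (rule that)
  show ?thesis
  proof (rule that [of T T' "P @ map (shift (length P)) Q" e "shift (length P) e'"])
    show "\<exists>t\<le>T x. eval (P @ map (shift (length P)) Q) (env E x) e (G x) t" if "x \<in> S" for x
      using 1(2) [OF that] eval_append by blast
    show "\<exists>t\<le>T' x. eval (P @ map (shift (length P)) Q) (env E' x) (shift (length P) e') (G' x) t"
      if "x \<in> S'" for x
      using 2(2) [OF that] eval_prepend by blast
  qed (fact 1 2)+
qed

lemma polytime_Leaf: "polytime S E (\<lambda>_. Leaf)"
  by (rule polytimeI [where T = "\<lambda>_. 1" and e = LeafE]) (auto intro: eval_intros polybdd_const)

lemma polytime_var:
  assumes "G \<in> set E"
  shows "polytime S E G"
proof -
  obtain i where i: "i < length E" "E ! i = G" using assms by (auto simp: in_set_conv_nth)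
  show ?thesis
  proof (rule polytimeI [of S E "\<lambda>x. 1 + env_size E x" _ "Var i"])
    show "\<exists>t\<le>1 + env_size E x. eval [] (env E x) (Var i) (G x) t" for x
      using eval_Var [of i "env E x" "[]"] i size_le_env_size [OF assms, of x]
      by (intro exI [of _ "1 + size (G x)"]) (auto simp: env_def)
  qed (intro polybdd_intros)
qed

lemma polytime_Node:
  assumes "polytime S E G" "polytime S E H"
  shows "polytime S E (\<lambda>x. Node (G x) (H x))"
proof -
  from assms obtain P e e' T T' where *: "polybdd S E T" "polybdd S E T'"
    "\<And>x. x \<in> S \<Longrightarrow> \<exists>t\<le>T x. eval P (env E x) e (G x) t"
    "\<And>x. x \<in> S \<Longrightarrow> \<exists>t\<le>T' x. eval P (env E x) e' (H x) t" by (rule polytimeE2) (rule that)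
  show ?thesis
  proof (rule polytimeI [of S E "\<lambda>x. 1 + T x + T' x" P "NodeE e e'"])
    fix x assume "x \<in> S"
    then obtain t t' where "t \<le> T x" "eval P (env E x) e (G x) t"
      "t' \<le> T' x" "eval P (env E x) e' (H x) t'" using * by meson
    then show "\<exists>t\<le>1 + T x + T' x. eval P (env E x) (NodeE e e') (Node (G x) (H x)) t"
      by (intro exI [of _ "1 + t + t'"]) (auto intro: eval_intros)
  qed (intro polybdd_intros *(1,2))
qed

lemma polytime_left: "polytime S E G \<Longrightarrow> polytime S E (\<lambda>x. left (G x))"
  and polytime_right: "polytime S E G \<Longrightarrow> polytime S E (\<lambda>x. right (G x))"
proof -
  assume "polytime S E G"
  then obtain P e T where T: "polybdd S E T" and
    *: "\<And>x. x \<in> S \<Longrightarrow> \<exists>t\<le>T x. eval P (env E x) e (G x) t" by (rule polytimeE) (rule that)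
  show "polytime S E (\<lambda>x. left (G x))"
  proof (rule polytimeI [of S E "\<lambda>x. 1 + T x" P "Left e"])
    fix x assume "x \<in> S"
    then obtain t where "t \<le> T x" "eval P (env E x) e (G x) t" using * by auto
    then show "\<exists>t\<le>1 + T x. eval P (env E x) (Left e) (left (G x)) t"
      by (intro exI [of _ "1 + t"]) (simp add: eval_intros)
  qed (intro polybdd_intros T)
  show "polytime S E (\<lambda>x. right (G x))"
  proof (rule polytimeI [of S E "\<lambda>x. 1 + T x" P "Right e"])
    fix x assume "x \<in> S"
    then obtain t where "t \<le> T x" "eval P (env E x) e (G x) t" using * by auto
    then show "\<exists>t\<le>1 + T x. eval P (env E x) (Right e) (right (G x)) t"
      by (intro exI [of _ "1 + t"]) (simp add: eval_intros)
  qed (intro polybdd_intros T)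
qed

lemma polytime_if_Leaf:
  assumes "polytime S E C" "polytime {x\<in>S. C x \<noteq> Leaf} E G" "polytime {x\<in>S. C x = Leaf} E H"
  shows "polytime S E (\<lambda>x. if C x \<noteq> Leaf then G x else H x)"
proof -
  let ?S1 = "{x\<in>S. C x \<noteq> Leaf}" and ?S2 = "{x\<in>S. C x = Leaf}"
  from assms(2,3) obtain Q e e' T T' where *: "polybdd ?S1 E T" "polybdd ?S2 E T'"
    "\<And>x. x \<in> ?S1 \<Longrightarrow> \<exists>t\<le>T x. eval Q (env E x) e (G x) t"
    "\<And>x. x \<in> ?S2 \<Longrightarrow> \<exists>t\<le>T' x. eval Q (env E x) e' (H x) t" by (rule polytimeE2) (rule that)
  obtain P c U where c: "polybdd S E U" "\<And>x. x \<in> S \<Longrightarrow> \<exists>t\<le>U x. eval P (env E x) c (C x) t"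
    using assms(1) by (rule polytimeE) (rule that)
  define R where "R = P @ map (shift (length P)) Q"
  obtain p p' where p: "\<And>x. x \<in> ?S1 \<Longrightarrow> T x \<le> poly p (env_size E x)"
    "\<And>x. x \<in> ?S2 \<Longrightarrow> T' x \<le> poly p' (env_size E x)"
    using *(1,2) unfolding polybdd_def by (elim exE) (rule that, auto)
  \<comment> \<open>\<open>T\<close> and \<open>T'\<close> are controlled only on their own branch;
    their polynomials give a bound on all of \<open>S\<close>.\<close>
  let ?V = "\<lambda>x. 1 + U x + (poly p (env_size E x) + poly p' (env_size E x))"
  let ?e = "If c (shift (length P) e) (shift (length P) e')"
  show ?thesis
  proof (rule polytimeI [of S E ?V R ?e])
    fix x assume x: "x \<in> S"
    obtain s where s: "s \<le> U x" "eval R (env E x) c (C x) s"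
      using c(2) [OF x] eval_append unfolding R_def by blast
    show "\<exists>t\<le>?V x. eval R (env E x) ?e (if C x \<noteq> Leaf then G x else H x) t"
    proof (cases "C x = Leaf")
      case False
      then obtain t where t: "t \<le> T x" "eval R (env E x) (shift (length P) e) (G x) t"
        using *(3) [of x] x eval_prepend unfolding R_def by blast
      with s p(1) [of x] x False show ?thesis
        by (intro exI [of _ "1 + s + t"]) (auto intro: eval_intros)
    next
      case True
      then obtain t where t: "t \<le> T' x" "eval R (env E x) (shift (length P) e') (H x) t"
        using *(4) [of x] x eval_prepend unfolding R_def by blast
      with s p(2) [of x] x True show ?thesis
        by (intro exI [of _ "1 + s + t"]) (auto intro: eval_intros)
    qed
  qed (intro polybdd_intros c(1))
qed

lemma polytime_evals:
  assumes "\<And>G. G \<in> set Gs \<Longrightarrow> polytime S E G"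
  shows "\<exists>P es T. polybdd S E T \<and> (\<forall>x\<in>S. \<exists>t\<le>T x. evals P (env E x) es (env Gs x) t)"
  using assms
proof (induction Gs)
  case Nil
  show ?case
    by (intro exI [of _ "[]"] exI [of _ "\<lambda>_. 0"]) (auto intro: eval_intros polybdd_const)
next
  case (Cons G Gs)
  then obtain Q es T where 1: "polybdd S E T" "\<forall>x\<in>S. \<exists>t\<le>T x. evals Q (env E x) es (env Gs x) t"
    by auto
  obtain P e U where 2: "polybdd S E U" "\<And>x. x \<in> S \<Longrightarrow> \<exists>t\<le>U x. eval P (env E x) e (G x) t"
    by (rule polytimeE [OF Cons.prems [of G]]) (simp, rule that)
  define R where "R = P @ map (shift (length P)) Q"
  show ?case
  proof (rule exI [of _ R], rule exI [of _ "e # map (shift (length P)) es"],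
      rule exI [of _ "\<lambda>x. U x + T x"], intro conjI ballI)
    fix x assume x: "x \<in> S"
    obtain s where s: "s \<le> U x" "eval R (env E x) e (G x) s"
      using 2(2) x eval_append unfolding R_def by blast
    obtain t where t: "t \<le> T x" "evals R (env E x) (map (shift (length P)) es) (env Gs x) t"
      using 1(2) x evals_prepend unfolding R_def by blast
    show "\<exists>t\<le>U x + T x. evals R (env E x) (e # map (shift (length P)) es) (env (G # Gs) x) t"
      using s t by (intro exI [of _ "s + t"]) (auto intro: eval_intros)
  qed (intro polybdd_intros 1(1) 2(1))
qed

text \<open>Composition: \<open>H\<close> becomes a further function, called on the values of
  \<open>Gs\<close>. These values have total size at most the time \<open>T x\<close> spent on them,
  so the call costs at most \<open>poly p (T x)\<close>.\<close>

lemma polytime_cut: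
  assumes H: "polytime S Gs H" and Gs: "\<And>G. G \<in> set Gs \<Longrightarrow> polytime S E G"
  shows "polytime S E H"
proof -
  obtain P es T where 1: "polybdd S E T" "\<And>x. x \<in> S \<Longrightarrow> \<exists>t\<le>T x. evals P (env E x) es (env Gs x) t"
  proof -
    have "\<exists>P es T. polybdd S E T \<and> (\<forall>x\<in>S. \<exists>t\<le>T x. evals P (env E x) es (env Gs x) t)"
      by (rule polytime_evals) (rule Gs)
    then show ?thesis by (elim exE conjE) (rule that, auto)
  qed
  obtain Q e U where 2: "polybdd S Gs U" "\<And>x. x \<in> S \<Longrightarrow> \<exists>t\<le>U x. eval Q (env Gs x) e (H x) t"
    using H by (rule polytimeE) (rule that)
  obtain p where p: "\<And>x. x \<in> S \<Longrightarrow> U x \<le> poly p (env_size Gs x)"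
    using 2(1) unfolding polybdd_def by (elim exE) (rule that, auto)
  define R where "R = P @ map (shift (length P)) Q"
  define R' where "R' = R @ [shift (length P) e]"
  show ?thesis
  proof (rule polytimeI [of S E "\<lambda>x. 1 + T x + poly p (T x)" R' "Call (length R) es"])
    fix x assume x: "x \<in> S"
    obtain s where s: "s \<le> T x" "evals R' (env E x) es (env Gs x) s"
      using 1(2) [OF x] evals_append unfolding R_def R'_def by blast
    obtain t where t: "t \<le> U x" "eval R' (env Gs x) (R' ! length R) (H x) t"
      using 2(2) [OF x] eval_append [OF eval_prepend [of Q _ e _ _ P], of _ _ _ "[shift (length P) e]"]
      unfolding R_def [symmetric] R'_def by auto
    have "env_size Gs x \<le> T x" using s eval_size_less(2) [OF s(2)] by (simp add: sum_list_size_env)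
    then have "t \<le> poly p (T x)"
      using t(1) p [OF x] poly_nat_mono [of "env_size Gs x" "T x" p] by linarith
    then show "\<exists>t\<le>1 + T x + poly p (T x). eval R' (env E x) (Call (length R) es) (H x) t"
      using s t eval_Call [OF s(2) _ t(2)]
      by (intro exI [of _ "1 + s + t"]) (auto simp: R'_def)
  qed (intro polybdd_intros 1(1))
qed

lemma polytime_weaken: "polytime S E H \<Longrightarrow> set E \<subseteq> set E' \<Longrightarrow> polytime S E' H"
  by (rule polytime_cut [of S E H], assumption) (rule polytime_var, rule subsetD)

section \<open>Iteration over encoded lists\<close>

lemma enc_list_simps [simp]:
  "enc_list enc [] = Leaf" "enc_list enc (x # xs) = Node (enc x) (enc_list enc xs)"
  by (auto simp: enc_list_def)

lemma size_enc_list: "size (enc_list enc xs) = (\<Sum>x\<leftarrow>xs. Suc (size (enc x)))"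
  by (induction xs) auto

lemma length_le_size_enc_list: "length xs \<le> size (enc_list enc xs)"
  by (induction xs) auto

lemma size_elem_enc_list: "x \<in> set xs \<Longrightarrow> size (enc x) < size (enc_list enc xs)"
  by (induction xs) auto

text \<open>The body of an iteration has further variables for the element and the accumulator, so
  its instances are tuples that start with the instance of the surrounding computation.\<close>

definition lift_env :: "('x \<Rightarrow> tree) list \<Rightarrow> ('x \<times> 'y \<Rightarrow> tree) list" where
  "lift_env E = map (\<lambda>f z. f (fst z)) E"

lemma lift_env_simps [simp]:
  "lift_env [] = []" "lift_env (f # E) = (\<lambda>z. f (fst z)) # lift_env E"
  "length (lift_env E) = length E"
  by (auto simp: lift_env_def)

lemma env_lift_env [simp]: "env (lift_env E) z = env E (fst z)"
  "env_size (lift_env E) z = env_size E (fst z)"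
  by (auto simp: lift_env_def env_def env_size_def comp_def)

text \<open>The accumulators that occur during the iteration must have polynomially bounded size;
  otherwise the rule would allow iterated squaring.\<close>

lemma polytime_fold:
  fixes ee :: "'e \<Rightarrow> tree" and eb :: "'b \<Rightarrow> tree" and step :: "'x \<Rightarrow> 'e \<Rightarrow> 'b \<Rightarrow> 'b"
  defines "S' xs init \<equiv> \<lambda>S. {(x, e, b). x \<in> S \<and> (\<exists>ys zs. xs x = ys @ e # zs \<and> b = fold (step x) ys (init x))}"
  assumes L: "polytime S E (\<lambda>x. enc_list ee (xs x))"
    and I: "polytime S E (\<lambda>x. eb (init x))"
    and St: "polytime (S' xs init S)
      ((\<lambda>z. ee (fst (snd z))) # (\<lambda>z. eb (snd (snd z))) # lift_env E)
      (\<lambda>z. eb (step (fst z) (fst (snd z)) (snd (snd z))))"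
    and bound: "polybdd S E h"
      "\<And>x ys zs. x \<in> S \<Longrightarrow> xs x = ys @ zs \<Longrightarrow> size (eb (fold (step x) ys (init x))) \<le> h x"
  shows "polytime S E (\<lambda>x. eb (fold (step x) (xs x) (init x)))"
proof -
  obtain P e1 e2 T1 T2 where 1: "polybdd S E T1" "polybdd S E T2"
    "\<And>x. x \<in> S \<Longrightarrow> \<exists>t\<le>T1 x. eval P (env E x) e1 (enc_list ee (xs x)) t"
    "\<And>x. x \<in> S \<Longrightarrow> \<exists>t\<le>T2 x. eval P (env E x) e2 (eb (init x)) t"
    using L I by (rule polytimeE2) (rule that)
  let ?E' = "(\<lambda>z. ee (fst (snd z))) # (\<lambda>z. eb (snd (snd z))) # lift_env E"
  obtain Q e3 T3 where 3: "polybdd (S' xs init S) ?E' T3"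
    "\<And>z. z \<in> S' xs init S \<Longrightarrow> \<exists>t\<le>T3 z. eval Q (env ?E' z) e3 (eb (step (fst z) (fst (snd z)) (snd (snd z)))) t"
    using St by (rule polytimeE) (rule that)
  obtain p where p: "\<And>z. z \<in> S' xs init S \<Longrightarrow> T3 z \<le> poly p (env_size ?E' z)"
    using 3(1) unfolding polybdd_def by (elim exE) (rule that, auto)
  define R where "R = P @ map (shift (length P)) Q"
  define m where "m = length E"
  \<comment> \<open>In the loop function, variable 0 is the remaining list, variable 1 the
    accumulator, and the variables from 2 on are the environment, which is handed on
    unchanged.\<close>
  define params where "params = map Var [2..<2 + m]"
  define stp where "stp = Call (length R) (Left (Var 0) # Var 1 # params)"
  define body where "body = If (Var 0) (Call (Suc (length R)) (Right (Var 0) # stp # params)) (Var 1)"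
  define R' where "R' = R @ [shift (length P) e3, body]"
  \<comment> \<open>\<open>sz x\<close> bounds the size of every environment of a step together with
    the number of variables, and \<open>K x\<close> the cost of one round; the factors 10 leave room
    for the few times the list, the accumulator and the environment are read per round.\<close>
  define len where "len x = size (enc_list ee (xs x))" for x
  define sz where "sz x = len x + h x + env_size E x + m" for x
  define K where "K x = 10 + 10 * sz x + poly p (sz x)" for x
  have loop: "\<exists>t\<le>Suc (length zs) * K x.
      eval R' (enc_list ee zs # eb (fold (step x) ys (init x)) # env E x) body
        (eb (fold (step x) (xs x) (init x))) t"
    if x: "x \<in> S" and "xs x = ys @ zs" for x ys zs
    using that(2)
  proof (induction zs arbitrary: ys)
    case Nil
    let ?\<rho> = "enc_list ee [] # eb (fold (step x) ys (init x)) # env E x"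
    have "eval R' ?\<rho> (Var 0) Leaf 1"
      using eval_Var [of 0 ?\<rho> R'] by simp
    moreover have "eval R' ?\<rho> (Var 1) (eb (fold (step x) ys (init x)))
        (1 + size (eb (fold (step x) ys (init x))))"
      using eval_Var [of 1 ?\<rho> R'] by simp
    ultimately have "eval R' ?\<rho> body (eb (fold (step x) ys (init x)))
        (1 + 1 + (1 + size (eb (fold (step x) ys (init x)))))"
      unfolding body_def by (rule eval_If_False)
    moreover have "size (eb (fold (step x) ys (init x))) \<le> h x"
      using bound(2) [OF x Nil] .
    ultimately show ?case
      using Nil by (intro exI [of _ "1 + 1 + (1 + size (eb (fold (step x) ys (init x))))"])
        (simp add: K_def sz_def)
  next
    case (Cons e zs)
    let ?b = "fold (step x) ys (init x)"
    let ?\<rho> = "enc_list ee (e # zs) # eb ?b # env E x"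
    let ?z = "(x, e, ?b)"
    have z: "?z \<in> S' xs init S" using Cons.prems x by (auto simp: S'_def)
    have sb: "size (eb ?b) \<le> h x" using bound(2) [OF x Cons.prems] .
    have "size (enc_list ee (e # zs)) \<le> len x"
      unfolding len_def Cons.prems by (simp add: size_enc_list)
    then have se: "size (ee e) + size (enc_list ee zs) + 1 \<le> len x" by simp
    have v0: "eval R' ?\<rho> (Var 0) (enc_list ee (e # zs)) (1 + size (enc_list ee (e # zs)))"
      using eval_Var [of 0 ?\<rho> R'] by simp
    have v1: "eval R' ?\<rho> (Var 1) (eb ?b) (1 + size (eb ?b))"
      using eval_Var [of 1 ?\<rho> R'] by simp
    have vE: "evals R' ?\<rho> params (env E x) (m + env_size E x)"
      using evals_map_Var [of R' "[enc_list ee (e # zs), eb ?b]" "env E x"]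
      unfolding params_def by (simp add: m_def sum_list_size_env numeral_2_eq_2)
    obtain t3 where t3: "t3 \<le> T3 ?z" "eval Q (env ?E' ?z) e3 (eb (step x e ?b)) t3"
      using 3(2) [OF z] by auto
    have "eval R' (env ?E' ?z) (R' ! length R) (eb (step x e ?b)) t3"
      using eval_append [OF eval_prepend [OF t3(2), of P], of "[shift (length P) e3, body]"]
      unfolding R'_def R_def [symmetric] by (simp add: nth_append)
    then have s3: "eval R' (ee e # eb ?b # env E x) (R' ! length R) (eb (step x e ?b)) t3" by simp
    have vL: "eval R' ?\<rho> (Left (Var 0)) (ee e) (1 + (1 + size (enc_list ee (e # zs))))"
      using eval_Left [OF v0] by simp
    define ts where "ts = 1 + ((1 + (1 + size (enc_list ee (e # zs)))) + ((1 + size (eb ?b)) + (m + env_size E x))) + t3"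
    have st: "eval R' ?\<rho> stp (eb (step x e ?b)) ts"
      unfolding stp_def ts_def
      by (rule eval_Call [OF evals_Cons [OF vL evals_Cons [OF v1 vE]] _ s3]) (simp add: R'_def)
    have vR: "eval R' ?\<rho> (Right (Var 0)) (enc_list ee zs) (1 + (1 + size (enc_list ee (e # zs))))"
      using eval_Right [OF v0] by simp
    from Cons.IH [of "ys @ [e]"] Cons.prems obtain t where t: "t \<le> Suc (length zs) * K x"
      "eval R' (enc_list ee zs # eb (step x e ?b) # env E x) body
        (eb (fold (step x) (xs x) (init x))) t" by auto
    have b: "R' ! Suc (length R) = body" by (simp add: R'_def nth_append)
    have c: "eval R' ?\<rho> (Call (Suc (length R)) (Right (Var 0) # stp # params))
        (eb (fold (step x) (xs x) (init x)))
        (1 + ((1 + (1 + size (enc_list ee (e # zs)))) + (ts + (m + env_size E x))) + t)"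
      by (rule eval_Call [OF evals_Cons [OF vR evals_Cons [OF st vE]]])
        (use t(2) in \<open>simp_all add: R'_def nth_append\<close>)
    have "env_size ?E' ?z \<le> sz x" using se sb by (simp add: sz_def)
    then have "t3 \<le> poly p (sz x)" using t3(1) p [OF z] poly_nat_mono [of "env_size ?E' ?z" "sz x" p]
      by linarith
    then have "(1 + (1 + size (enc_list ee (e # zs))) +
        (1 + ((1 + (1 + size (enc_list ee (e # zs)))) + (ts + (m + env_size E x))) + t))
        \<le> Suc (length (e # zs)) * K x"
      using se sb t(1) by (simp add: ts_def K_def sz_def)
    moreover have "eval R' ?\<rho> body (eb (fold (step x) (xs x) (init x)))
      (1 + (1 + size (enc_list ee (e # zs))) +
        (1 + ((1 + (1 + size (enc_list ee (e # zs)))) + (ts + (m + env_size E x))) + t))"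
      unfolding body_def by (rule eval_If_True [OF v0 _ c]) simp
    ultimately show ?case by (intro exI [of _ "1 + (1 + size (enc_list ee (e # zs))) +
        (1 + ((1 + (1 + size (enc_list ee (e # zs)))) + (ts + (m + env_size E x))) + t)"]) simp
  qed
  define V where "V x = 1 + (T1 x + (T2 x + (m + env_size E x))) + Suc (len x) * K x" for x
  show ?thesis
  proof (rule polytimeI [of S E V R' "Call (Suc (length R)) (e1 # e2 # map Var [0..<m])"])
    fix x assume x: "x \<in> S"
    obtain t1 where t1: "t1 \<le> T1 x" "eval R' (env E x) e1 (enc_list ee (xs x)) t1"
      using 1(3) [OF x] eval_append unfolding R_def R'_def by blast
    obtain t2 where t2: "t2 \<le> T2 x" "eval R' (env E x) e2 (eb (init x)) t2"
      using 1(4) [OF x] eval_append unfolding R_def R'_def by blast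
    have vE: "evals R' (env E x) (map Var [0..<m]) (env E x) (m + env_size E x)"
      using evals_map_Var [of R' "[]" "env E x"] by (simp add: m_def sum_list_size_env)
    obtain t where t: "t \<le> Suc (length (xs x)) * K x"
      "eval R' (enc_list ee (xs x) # eb (init x) # env E x) (R' ! Suc (length R))
        (eb (fold (step x) (xs x) (init x))) t"
      using loop [OF x, of "[]" "xs x"] by (auto simp: R'_def nth_append)
    have "length (xs x) \<le> len x" by (simp add: len_def length_le_size_enc_list)
    then have "t \<le> Suc (len x) * K x"
      using t(1) by (meson Suc_le_mono le_trans mult_le_mono1)
    moreover have "eval R' (env E x) (Call (Suc (length R)) (e1 # e2 # map Var [0..<m]))
      (eb (fold (step x) (xs x) (init x))) (1 + (t1 + (t2 + (m + env_size E x))) + t)"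
      by (rule eval_Call [OF evals_Cons [OF t1(2) evals_Cons [OF t2(2) vE]] _ t(2)]) (simp add: R'_def)
    ultimately show "\<exists>t\<le>V x. eval R' (env E x) (Call (Suc (length R)) (e1 # e2 # map Var [0..<m]))
        (eb (fold (step x) (xs x) (init x))) t"
      using t1(1) t2(1) unfolding V_def
      by (intro exI [of _ "1 + (t1 + (t2 + (m + env_size E x))) + t"]) simp
  next
    show "polybdd S E V"
      unfolding V_def K_def sz_def len_def
      by (intro polybdd_intros 1(1,2) bound(1) polytime_size [OF L])
  qed
qed

section \<open>Polynomial time on encoded values\<close>

text \<open>Keeping the encoding and the function apart makes the rules below first-order, so that
  they can be applied by unification.\<close>

definition ptime :: "'x set \<Rightarrow> ('x \<Rightarrow> tree) list \<Rightarrow> ('b \<Rightarrow> tree) \<Rightarrow> ('x \<Rightarrow> 'b) \<Rightarrow> bool" where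
  "ptime S E enc f \<longleftrightarrow> polytime S E (\<lambda>x. enc (f x))"

lemma ptime_cong: "ptime S E enc f \<Longrightarrow> (\<And>x. x \<in> S \<Longrightarrow> g x = f x) \<Longrightarrow> ptime S E enc g"
  unfolding ptime_def by (rule polytime_cong [of S E "\<lambda>x. enc (f x)"]) simp_all

lemma ptime_subset: "ptime S E enc f \<Longrightarrow> S' \<subseteq> S \<Longrightarrow> ptime S' E enc f"
  unfolding ptime_def by (rule polytime_subset)

lemma ptime_weaken: "ptime S E enc f \<Longrightarrow> set E \<subseteq> set E' \<Longrightarrow> ptime S E' enc f"
  unfolding ptime_def by (rule polytime_weaken)

lemma ptime_var: "(\<lambda>x. enc (f x)) \<in> set E \<Longrightarrow> ptime S E enc f"
  unfolding ptime_def by (rule polytime_var)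

lemma ptime_reindex:
  assumes "ptime S E enc f" "\<And>y. y \<in> S' \<Longrightarrow> h y \<in> S"
  shows "ptime S' (map (\<lambda>f y. f (h y)) E) enc (\<lambda>y. f (h y))"
  using polytime_reindex [OF assms(1) [unfolded ptime_def] assms(2)] unfolding ptime_def .

lemma ptime_lift:
  assumes "ptime S E enc f" "fst ` S' \<subseteq> S"
  shows "ptime S' (lift_env E) enc (\<lambda>z. f (fst z))"
  unfolding lift_env_def by (rule ptime_reindex [OF assms(1)]) (use assms(2) in auto)

lemma ptime_lift1: "ptime S E enc f \<Longrightarrow> fst ` S' \<subseteq> S \<Longrightarrow> ptime S' (a # lift_env E) enc (\<lambda>z. f (fst z))"
  and ptime_lift2: "ptime S E enc f \<Longrightarrow> fst ` S' \<subseteq> S \<Longrightarrow>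
    ptime S' (a # b # lift_env E) enc (\<lambda>z. f (fst z))"
  by (erule ptime_weaken [OF ptime_lift]; auto)+

lemma ptime_size: "ptime S E enc f \<Longrightarrow> polybdd S E (\<lambda>x. size (enc (f x)))"
  unfolding ptime_def by (rule polytime_size)

lemma ptime_fold:
  fixes ee :: "'e \<Rightarrow> tree" and eb :: "'b \<Rightarrow> tree" and step :: "'x \<Rightarrow> 'e \<Rightarrow> 'b \<Rightarrow> 'b"
  assumes "ptime S E (enc_list ee) xs" and "ptime S E eb init"
    and "ptime {(x, e, b). x \<in> S \<and> (\<exists>ys zs. xs x = ys @ e # zs \<and> b = fold (step x) ys (init x))}
      ((\<lambda>z. ee (fst (snd z))) # (\<lambda>z. eb (snd (snd z))) # lift_env E) eb
      (\<lambda>z. step (fst z) (fst (snd z)) (snd (snd z)))"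
    and "polybdd S E h"
      "\<And>x ys zs. x \<in> S \<Longrightarrow> xs x = ys @ zs \<Longrightarrow> size (eb (fold (step x) ys (init x))) \<le> h x"
  shows "ptime S E eb (\<lambda>x. fold (step x) (xs x) (init x))"
  unfolding ptime_def
  by (rule polytime_fold [where xs = xs and ee = ee and eb = eb and step = step and h = h])
    (use assms in \<open>unfold ptime_def\<close>)

text \<open>An invariant replaces the description of the accumulators that occur, and supplies both
  the premise of the step and the size bound.\<close>

lemma ptime_fold_inv:
  fixes ee :: "'e \<Rightarrow> tree" and eb :: "'b \<Rightarrow> tree" and step :: "'x \<Rightarrow> 'e \<Rightarrow> 'b \<Rightarrow> 'b"
  assumes L: "ptime S E (enc_list ee) xs" and I: "ptime S E eb init"
    and St: "ptime {(x, e, b). x \<in> S \<and> e \<in> set (xs x) \<and> Inv x b}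
      ((\<lambda>z. ee (fst (snd z))) # (\<lambda>z. eb (snd (snd z))) # lift_env E) eb
      (\<lambda>z. step (fst z) (fst (snd z)) (snd (snd z)))"
    and Inv: "\<And>x. x \<in> S \<Longrightarrow> Inv x (init x)"
      "\<And>x e b. x \<in> S \<Longrightarrow> e \<in> set (xs x) \<Longrightarrow> Inv x b \<Longrightarrow> Inv x (step x e b)"
    and bound: "polybdd S E h" "\<And>x b. x \<in> S \<Longrightarrow> Inv x b \<Longrightarrow> size (eb b) \<le> h x"
  shows "ptime S E eb (\<lambda>x. fold (step x) (xs x) (init x))"
proof -
  have *: "Inv x (fold (step x) ys (init x))" if "x \<in> S" "set ys \<subseteq> set (xs x)" for x ys
    using that(2) by (induction ys rule: rev_induct) (auto intro: Inv that(1))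
  show ?thesis
  proof (rule ptime_fold [OF L I _ bound(1)])
    show "size (eb (fold (step x) ys (init x))) \<le> h x" if "x \<in> S" "xs x = ys @ zs" for x ys zs
      using that by (intro bound(2) *) auto
  qed (rule ptime_subset [OF St], auto intro: *)
qed

text \<open>Additive growth per round stays polynomial, because the number of rounds is at most the
  size of the encoded list.\<close>

lemma ptime_fold_incr:
  fixes ee :: "'e \<Rightarrow> tree" and eb :: "'b \<Rightarrow> tree" and step :: "'x \<Rightarrow> 'e \<Rightarrow> 'b \<Rightarrow> 'b"
  assumes L: "ptime S E (enc_list ee) xs" and I: "ptime S E eb init"
    and St: "ptime {(x, e, b). x \<in> S \<and> e \<in> set (xs x)}
      ((\<lambda>z. ee (fst (snd z))) # (\<lambda>z. eb (snd (snd z))) # lift_env E) eb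
      (\<lambda>z. step (fst z) (fst (snd z)) (snd (snd z)))"
    and bound: "polybdd S E h"
      "\<And>x e b. x \<in> S \<Longrightarrow> e \<in> set (xs x) \<Longrightarrow> size (eb (step x e b)) \<le> size (eb b) + h x"
  shows "ptime S E eb (\<lambda>x. fold (step x) (xs x) (init x))"
proof -
  have *: "size (eb (fold (step x) ys (init x))) \<le> size (eb (init x)) + length ys * h x"
    if "x \<in> S" "set ys \<subseteq> set (xs x)" for x ys
    using that(2)
  proof (induction ys rule: rev_induct)
    case (snoc e ys)
    then show ?case
      using bound(2) [OF that(1), of e "fold (step x) ys (init x)"] by simp
  qed simp
  show ?thesis
  proof (rule ptime_fold [OF L I])
    show "size (eb (fold (step x) ys (init x)))
        \<le> size (eb (init x)) + size (enc_list ee (xs x)) * h x"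
      if "x \<in> S" "xs x = ys @ zs" for x ys zs
    proof -
      have "length ys \<le> size (enc_list ee (xs x))"
        using length_le_size_enc_list [of "xs x" ee] that(2) by simp
      then have "length ys * h x \<le> size (enc_list ee (xs x)) * h x" by simp
      then show ?thesis using * [of x ys] that by (fastforce intro: order_trans)
    qed
    show "polybdd S E (\<lambda>x. size (eb (init x)) + size (enc_list ee (xs x)) * h x)"
      by (rule polybdd_add [OF ptime_size [OF I] polybdd_mult [OF ptime_size [OF L] bound(1)]])
  qed (rule ptime_subset [OF St], auto)
qed

section \<open>Operations on lists\<close>

lemma ptime_Nil: "ptime S E (enc_list ee) (\<lambda>x. [])"
  by (simp add: polytime_Leaf ptime_def)

lemma ptime_Cons:
  "ptime S E ee a \<Longrightarrow> ptime S E (enc_list ee) xs \<Longrightarrow> ptime S E (enc_list ee) (\<lambda>x. a x # xs x)"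
  by (simp add: polytime_Node ptime_def)

text \<open>Moving elements from one list to another reverses them. Reversal is the case of an empty
  target, and \<open>append\<close> follows by reversing the first list beforehand.\<close>

lemma ptime_append_rev:
  assumes "ptime S E (enc_list ee) xs" "ptime S E (enc_list ee) ys"
  shows "ptime S E (enc_list ee) (\<lambda>x. rev (xs x) @ ys x)"
proof -
  have "ptime S E (enc_list ee) (\<lambda>x. fold (\<lambda>e b. e # b) (xs x) (ys x))"
  proof (rule ptime_fold_incr [OF assms, where h = "\<lambda>x. size (enc_list ee (xs x))"])
    show "size (enc_list ee (e # b)) \<le> size (enc_list ee b) + size (enc_list ee (xs x))"
      if "e \<in> set (xs x)" for e b x
      using size_elem_enc_list [of e "xs x" ee] that by simp
    show "polybdd S E (\<lambda>x. size (enc_list ee (xs x)))" by (rule ptime_size [OF assms(1)])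
  qed (intro ptime_Cons ptime_var; simp)
  moreover have "fold (\<lambda>e b. e # b) xs ys = rev xs @ ys" for xs ys :: "'b list"
    by (induction xs arbitrary: ys) auto
  ultimately show ?thesis by simp
qed

lemma ptime_rev: "ptime S E (enc_list ee) xs \<Longrightarrow> ptime S E (enc_list ee) (\<lambda>x. rev (xs x))"
  using ptime_append_rev [OF _ ptime_Nil] by fastforce

lemma ptime_append:
  assumes "ptime S E (enc_list ee) xs" "ptime S E (enc_list ee) ys"
  shows "ptime S E (enc_list ee) (\<lambda>x. xs x @ ys x)"
  using ptime_append_rev [OF ptime_rev [OF assms(1)] assms(2)] by simp

lemma ptime_foldr_incr:
  fixes ee :: "'e \<Rightarrow> tree" and eb :: "'b \<Rightarrow> tree" and step :: "'x \<Rightarrow> 'e \<Rightarrow> 'b \<Rightarrow> 'b"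
  assumes L: "ptime S E (enc_list ee) xs" and I: "ptime S E eb init"
    and St: "ptime {(x, e, b). x \<in> S \<and> e \<in> set (xs x)}
      ((\<lambda>z. ee (fst (snd z))) # (\<lambda>z. eb (snd (snd z))) # lift_env E) eb
      (\<lambda>z. step (fst z) (fst (snd z)) (snd (snd z)))"
    and "polybdd S E h"
      "\<And>x e b. x \<in> S \<Longrightarrow> e \<in> set (xs x) \<Longrightarrow> size (eb (step x e b)) \<le> size (eb b) + h x"
  shows "ptime S E eb (\<lambda>x. foldr (step x) (xs x) (init x))"
  unfolding foldr_conv_fold
  by (rule ptime_fold_incr [OF ptime_rev [OF L] I, where h = h], unfold set_rev) (fact assms)+

definition elems :: "'x set \<Rightarrow> ('x \<Rightarrow> 'e list) \<Rightarrow> ('x \<times> 'e) set" where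
  "elems S xs = {(x, e). x \<in> S \<and> e \<in> set (xs x)}"

text \<open>Turns a computation in the context of a list element into one in the context of a
  fold step.\<close>

lemma ptime_elem_step:
  assumes "ptime (elems S xs) ((\<lambda>z. ee (snd z)) # lift_env E) enc (\<lambda>z. g (fst z) (snd z))"
    and "\<And>x e b. (x, e, b) \<in> S' \<Longrightarrow> x \<in> S \<and> e \<in> set (xs x)"
  shows "ptime S' ((\<lambda>z. ee (fst (snd z))) # f # lift_env E) enc (\<lambda>z. g (fst z) (fst (snd z)))"
proof -
  have "ptime S' (map (\<lambda>f y. f (fst y, fst (snd y))) ((\<lambda>z. ee (snd z)) # lift_env E)) enc
      (\<lambda>y. g (fst (fst y, fst (snd y))) (snd (fst y, fst (snd y))))"
    by (rule ptime_reindex [OF assms(1)]) (use assms(2) in \<open>force simp: elems_def\<close>)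
  then have "ptime S' ((\<lambda>z. ee (fst (snd z))) # lift_env E) enc (\<lambda>z. g (fst z) (fst (snd z)))"
    by (simp add: lift_env_def comp_def)
  then show ?thesis by (rule ptime_weaken) auto
qed

text \<open>An element is encoded by a smaller tree than the list containing it, so a bound in terms
  of the element turns into one that is uniform over the list.\<close>

lemma polybdd_elem:
  assumes g: "ptime (elems S xs) ((\<lambda>z. ee (snd z)) # lift_env E) enc (\<lambda>z. g (fst z) (snd z))"
    and L: "ptime S E (enc_list ee) xs"
  obtains h where "polybdd S E h" "\<And>x e. x \<in> S \<Longrightarrow> e \<in> set (xs x) \<Longrightarrow> size (enc (g x e)) \<le> h x"
proof -
  obtain p where p: "\<And>z. z \<in> elems S xs \<Longrightarrow>
      size (enc (g (fst z) (snd z))) \<le> poly p (env_size ((\<lambda>z. ee (snd z)) # lift_env E) z)"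
    using ptime_size [OF g] unfolding polybdd_def by blast
  define h where "h x = poly p (size (enc_list ee (xs x)) + env_size E x)" for x
  show ?thesis
  proof (rule that [of h])
    show "polybdd S E h" unfolding h_def by (intro polybdd_intros ptime_size [OF L])
    fix x e assume *: "x \<in> S" "e \<in> set (xs x)"
    then have "size (enc (g x e)) \<le> poly p (size (ee e) + env_size E x)"
      using p [of "(x, e)"] by (simp add: elems_def)
    also have "\<dots> \<le> h x"
      unfolding h_def by (rule poly_nat_mono) (use size_elem_enc_list [OF *(2), of ee] in simp)
    finally show "size (enc (g x e)) \<le> h x" .
  qed
qed

lemma ptime_map:
  assumes L: "ptime S E (enc_list ee) xs"
    and g: "ptime (elems S xs) ((\<lambda>z. ee (snd z)) # lift_env E) eb (\<lambda>z. g (fst z) (snd z))"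
  shows "ptime S E (enc_list eb) (\<lambda>x. map (g x) (xs x))"
proof -
  obtain h where h: "polybdd S E h" "\<And>x e. x \<in> S \<Longrightarrow> e \<in> set (xs x) \<Longrightarrow> size (eb (g x e)) \<le> h x"
    using polybdd_elem [OF g L] by blast
  have "ptime S E (enc_list eb) (\<lambda>x. foldr (\<lambda>e b. g x e # b) (xs x) [])"
  proof (rule ptime_foldr_incr [OF L ptime_Nil])
    show "polybdd S E (\<lambda>x. Suc (h x))" by (rule polybdd_Suc [OF h(1)])
  qed (rule ptime_Cons [OF ptime_elem_step [OF g] ptime_var], auto intro: h(2))
  moreover have "foldr (\<lambda>e b. g x e # b) ys [] = map (g x) ys" for x ys
    by (induction ys) auto
  ultimately show ?thesis by simp
qed

lemma ptime_concat_map: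
  assumes L: "ptime S E (enc_list ee) xs"
    and g: "ptime (elems S xs) ((\<lambda>z. ee (snd z)) # lift_env E) (enc_list eb) (\<lambda>z. g (fst z) (snd z))"
  shows "ptime S E (enc_list eb) (\<lambda>x. concat (map (g x) (xs x)))"
proof -
  obtain h where h: "polybdd S E h"
    "\<And>x e. x \<in> S \<Longrightarrow> e \<in> set (xs x) \<Longrightarrow> size (enc_list eb (g x e)) \<le> h x"
    using polybdd_elem [OF g L] by blast
  have "ptime S E (enc_list eb) (\<lambda>x. foldr (\<lambda>e b. g x e @ b) (xs x) [])"
  proof (rule ptime_foldr_incr [OF L ptime_Nil _ h(1)])
    show "size (enc_list eb (g x e @ b)) \<le> size (enc_list eb b) + h x"
      if "x \<in> S" "e \<in> set (xs x)" for x e b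
      using h(2) [OF that] by (simp add: size_enc_list)
  qed (rule ptime_append [OF ptime_elem_step [OF g] ptime_var], auto)
  moreover have "foldr (\<lambda>e b. g x e @ b) ys [] = concat (map (g x) ys)" for x ys
    by (induction ys) auto
  ultimately show ?thesis by simp
qed

section \<open>Polynomial time on truth values\<close>

lemma enc_bool_simps [simp]: "enc_bool True = Node Leaf Leaf" "enc_bool False = Leaf"
  by (auto simp: enc_bool_def)

lemma enc_bool_eq_Leaf [simp]: "enc_bool b = Leaf \<longleftrightarrow> \<not> b"
  by (cases b) auto

lemma size_enc_bool: "size (enc_bool b) \<le> 1"
  by (cases b) auto

lemma ptime_if:
  assumes "ptime S E enc_bool c" "ptime {x\<in>S. c x} E eb a" "ptime {x\<in>S. \<not> c x} E eb b"
  shows "ptime S E eb (\<lambda>x. if c x then a x else b x)"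
proof -
  have "polytime S E (\<lambda>x. if enc_bool (c x) \<noteq> Leaf then eb (a x) else eb (b x))"
    by (rule polytime_if_Leaf) (use assms in \<open>simp_all add: ptime_def\<close>)
  then show ?thesis unfolding ptime_def by (rule polytime_cong) simp
qed

lemma ptime_if':
  assumes "ptime S E enc_bool c" "ptime S E eb a" "ptime S E eb b"
  shows "ptime S E eb (\<lambda>x. if c x then a x else b x)"
  by (rule ptime_if) (auto intro: assms ptime_subset)

lemma ptime_True: "ptime S E enc_bool (\<lambda>x. True)"
  and ptime_False: "ptime S E enc_bool (\<lambda>x. False)"
  by (simp_all add: polytime_Leaf polytime_Node ptime_def)

lemma ptime_not: "ptime S E enc_bool p \<Longrightarrow> ptime S E enc_bool (\<lambda>x. \<not> p x)"
  by (rule ptime_cong [OF ptime_if' [OF _ ptime_False ptime_True, of S E p]]) simp_all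

lemma ptime_conj:
  "ptime S E enc_bool p \<Longrightarrow> ptime S E enc_bool q \<Longrightarrow> ptime S E enc_bool (\<lambda>x. p x \<and> q x)"
  by (rule ptime_cong [OF ptime_if' [OF _ _ ptime_False, of S E p q]]) simp_all

lemma ptime_disj:
  "ptime S E enc_bool p \<Longrightarrow> ptime S E enc_bool q \<Longrightarrow> ptime S E enc_bool (\<lambda>x. p x \<or> q x)"
  by (rule ptime_cong [OF ptime_if' [OF _ ptime_True, of S E p q]]) simp_all

lemma ptime_bool_eq:
  "ptime S E enc_bool p \<Longrightarrow> ptime S E enc_bool q \<Longrightarrow> ptime S E enc_bool (\<lambda>x. p x = q x)"
  by (rule ptime_cong [OF ptime_if' [OF _ _ ptime_not, of S E p q q]]) simp_all

lemma ptime_filter: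
  assumes L: "ptime S E (enc_list ee) xs"
    and g: "ptime (elems S xs) ((\<lambda>z. ee (snd z)) # lift_env E) enc_bool (\<lambda>z. g (fst z) (snd z))"
  shows "ptime S E (enc_list ee) (\<lambda>x. filter (g x) (xs x))"
proof -
  have *: "ptime (elems S xs) ((\<lambda>z. ee (snd z)) # lift_env E) (enc_list ee)
      (\<lambda>z. if g (fst z) (snd z) then [snd z] else [])"
    by (rule ptime_if' [OF g ptime_Cons [OF ptime_var ptime_Nil] ptime_Nil]) simp
  have "concat (map (\<lambda>e. if g x e then [e] else []) ys) = filter (g x) ys" for x ys
    by (induction ys) auto
  then show ?thesis using ptime_concat_map [OF L *] by simp
qed

lemma ptime_null:
  assumes "ptime S E (enc_list ee) xs"
  shows "ptime S E enc_bool (\<lambda>x. xs x = [])"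
proof -
  have *: "enc_list ee ys = Leaf \<longleftrightarrow> ys = []" for ys by (cases ys) auto
  have "polytime S E (\<lambda>x. if enc_list ee (xs x) \<noteq> Leaf then enc_bool False else enc_bool True)"
    by (rule polytime_if_Leaf)
      (use assms ptime_True ptime_False in \<open>unfold ptime_def, blast+\<close>)
  then show ?thesis unfolding ptime_def by (rule polytime_cong) (simp add: *)
qed

lemma ptime_ball:
  assumes L: "ptime S E (enc_list ee) xs"
    and g: "ptime (elems S xs) ((\<lambda>z. ee (snd z)) # lift_env E) enc_bool (\<lambda>z. g (fst z) (snd z))"
  shows "ptime S E enc_bool (\<lambda>x. \<forall>e\<in>set (xs x). g x e)"
  using ptime_null [OF ptime_filter [OF L ptime_not [OF g]]] by (simp add: filter_empty_conv)

lemma ptime_bex: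
  assumes L: "ptime S E (enc_list ee) xs"
    and g: "ptime (elems S xs) ((\<lambda>z. ee (snd z)) # lift_env E) enc_bool (\<lambda>z. g (fst z) (snd z))"
  shows "ptime S E enc_bool (\<lambda>x. \<exists>e\<in>set (xs x). g x e)"
  using ptime_not [OF ptime_ball [OF L ptime_not [OF g]]] by simp

lemma polytime_const: "polytime S E (\<lambda>_. c)"
  by (induction c) (auto intro: polytime_Leaf polytime_Node)

lemma ptime_const: "ptime S E enc (\<lambda>_. c)"
  unfolding ptime_def by (rule polytime_const)

definition enc_pair :: "('b \<Rightarrow> tree) \<Rightarrow> ('c \<Rightarrow> tree) \<Rightarrow> 'b \<times> 'c \<Rightarrow> tree" where
  "enc_pair ea eb p = Node (ea (fst p)) (eb (snd p))"

lemma ptime_Pair: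
  "ptime S E ea a \<Longrightarrow> ptime S E eb b \<Longrightarrow> ptime S E (enc_pair ea eb) (\<lambda>x. (a x, b x))"
  by (simp add: ptime_def enc_pair_def polytime_Node)

lemma ptime_fst: "ptime S E (enc_pair ea eb) p \<Longrightarrow> ptime S E ea (\<lambda>x. fst (p x))"
  and ptime_snd: "ptime S E (enc_pair ea eb) p \<Longrightarrow> ptime S E eb (\<lambda>x. snd (p x))"
  unfolding ptime_def
  by (drule polytime_left polytime_right, simp add: enc_pair_def)+

section \<open>Binary arithmetic in polynomial time\<close>

lemma nat_bits_0 [simp]: "nat_bits 0 = []"
  by (simp add: nat_bits.simps)

lemma nat_bits_pos: "n > 0 \<Longrightarrow> nat_bits n = odd n # nat_bits (n div 2)"
  by (simp add: nat_bits.simps [of n])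

lemma nat_bits_eq_Nil [simp]: "nat_bits n = [] \<longleftrightarrow> n = 0"
  by (simp add: nat_bits.simps [of n])

lemma length_nat_bits_le_iff: "length (nat_bits n) \<le> k \<longleftrightarrow> n < 2 ^ k"
proof (induction k arbitrary: n)
  case (Suc k)
  show ?case
  proof (cases "n = 0")
    case False
    then show ?thesis using Suc [of "n div 2"] by (auto simp: nat_bits_pos)
  qed simp
qed simp

lemma length_nat_bits_mono: "m \<le> n \<Longrightarrow> length (nat_bits m) \<le> length (nat_bits n)"
  by (meson length_nat_bits_le_iff le_less_trans order_refl)

lemma length_nat_bits_le: "length (nat_bits n) \<le> n"
  by (simp add: length_nat_bits_le_iff less_exp)

lemma length_nat_bits_mult: "length (nat_bits (m * n)) \<le> length (nat_bits m) + length (nat_bits n)"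
proof -
  have "m < 2 ^ length (nat_bits m)" "n < 2 ^ length (nat_bits n)"
    by (simp_all add: length_nat_bits_le_iff [symmetric])
  then have "m * n < 2 ^ length (nat_bits m) * 2 ^ length (nat_bits n)"
    by (intro mult_strict_mono) auto
  then show ?thesis by (simp add: length_nat_bits_le_iff power_add)
qed

lemma enc_nat_0 [simp]: "enc_nat 0 = Leaf"
  by (simp add: enc_nat_def)

lemma enc_nat_pos: "n > 0 \<Longrightarrow> enc_nat n = Node (enc_bool (odd n)) (enc_nat (n div 2))"
  by (simp add: enc_nat_def nat_bits_pos)

lemma length_le_size_enc_nat: "length (nat_bits n) \<le> size (enc_nat n)"
  by (simp add: enc_nat_def length_le_size_enc_list)

lemma size_enc_nat: "size (enc_nat n) \<le> 2 * length (nat_bits n)"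
proof -
  have "size (enc_list enc_bool bs) \<le> 2 * length bs" for bs
    by (induction bs) (auto simp: enc_bool_def)
  then show ?thesis by (simp add: enc_nat_def)
qed

lemma size_enc_nat_le: "m \<le> n \<Longrightarrow> size (enc_nat m) \<le> 2 * n"
  by (meson size_enc_nat length_nat_bits_le le_trans mult_le_mono2)

lemma size_enc_nat_div2: "size (enc_nat (n div 2)) \<le> size (enc_nat n)"
  by (cases "n = 0") (auto simp: enc_nat_pos)

lemma ptime_nat_bits: "ptime S E enc_nat a \<Longrightarrow> ptime S E (enc_list enc_bool) (\<lambda>x. nat_bits (a x))"
  by (simp add: ptime_def enc_nat_def)

lemma ptime_div2: "ptime S E enc_nat a \<Longrightarrow> ptime S E enc_nat (\<lambda>x. a x div 2)"
  and ptime_odd: "ptime S E enc_nat a \<Longrightarrow> ptime S E enc_bool (\<lambda>x. odd (a x))"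
proof -
  have "enc_nat (n div 2) = right (enc_nat n)" "enc_bool (odd n) = left (enc_nat n)" for n
    by (cases "n = 0"; simp add: enc_nat_pos)+
  then show "ptime S E enc_nat a \<Longrightarrow> ptime S E enc_nat (\<lambda>x. a x div 2)"
    "ptime S E enc_nat a \<Longrightarrow> ptime S E enc_bool (\<lambda>x. odd (a x))"
    unfolding ptime_def by (simp_all add: polytime_left polytime_right)
qed

text \<open>Encodings have no leading zeros: a zero bit appended to the number zero must not create
  a node.\<close>

lemma enc_nat_bit:
  "enc_nat (of_bool d + 2 * n) = (if d \<or> n \<noteq> 0 then Node (enc_bool d) (enc_nat n) else Leaf)"
  by (cases d; cases "n = 0") (auto simp: enc_nat_pos)

lemma ptime_bit:
  assumes "ptime S E enc_bool d" "ptime S E enc_nat a"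
  shows "ptime S E enc_nat (\<lambda>x. of_bool (d x) + 2 * a x)"
proof -
  have "ptime S E enc_bool (\<lambda>x. d x \<or> nat_bits (a x) \<noteq> [])"
    by (intro ptime_disj ptime_not ptime_null [where ee = enc_bool] ptime_nat_bits assms)
  moreover have "polytime S E (\<lambda>x. Node (enc_bool (d x)) (enc_nat (a x)))"
    by (intro polytime_Node assms [unfolded ptime_def])
  ultimately have "ptime S E (\<lambda>t. t) (\<lambda>x. if d x \<or> nat_bits (a x) \<noteq> []
      then Node (enc_bool (d x)) (enc_nat (a x)) else Leaf)"
    by (intro ptime_if') (auto simp: ptime_def polytime_Leaf)
  then show ?thesis unfolding ptime_def by (rule polytime_cong) (simp add: enc_nat_bit)
qed

text \<open>Processes the bits of two numbers simultaneously, from the least significant bit on. The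
  number of rounds, the sum of the lengths, is only chosen so that no bit is missed.\<close>

definition bits_step :: "(bool \<Rightarrow> bool \<Rightarrow> 's \<Rightarrow> 's) \<Rightarrow> nat \<times> nat \<times> 's \<Rightarrow> nat \<times> nat \<times> 's" where
  "bits_step f s = (fst s div 2, fst (snd s) div 2, f (odd (fst s)) (odd (fst (snd s))) (snd (snd s)))"

definition bits_fold :: "(bool \<Rightarrow> bool \<Rightarrow> 's \<Rightarrow> 's) \<Rightarrow> nat \<Rightarrow> nat \<Rightarrow> 's \<Rightarrow> 's" where
  "bits_fold f a b s = snd (snd (fold (\<lambda>_. bits_step f) (nat_bits a @ nat_bits b) (a, b, s)))"

text \<open>Every round preserves \<open>val\<close>, and after enough rounds both numbers are 0. So
  the final state alone determines \<open>val a b s\<close>, which is chosen as the desired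
  result.\<close>

lemma bits_fold_invariant:
  assumes "\<And>a b s. val (a div 2) (b div 2) (f (odd a) (odd b) s) = val a b s"
  shows "val 0 0 (bits_fold f a b s) = val a b s"
proof -
  let ?val = "\<lambda>t. val (fst t) (fst (snd t)) (snd (snd t))"
  have 1: "fst (fold (\<lambda>_. bits_step f) xs t) = fst t div 2 ^ length xs \<and>
      fst (snd (fold (\<lambda>_. bits_step f) xs t)) = fst (snd t) div 2 ^ length xs"
    for xs :: "bool list" and t
    by (induction xs arbitrary: t) (auto simp: bits_step_def div_mult2_eq)
  have "?val (bits_step f t) = ?val t" for t
    by (simp add: bits_step_def assms)
  then have 2: "?val (fold (\<lambda>_. bits_step f) xs t) = ?val t" for xs :: "bool list" and t
    by (induction xs arbitrary: t) (simp_all del: split_paired_All)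
  have "a < 2 ^ length (nat_bits a @ nat_bits b)" "b < 2 ^ length (nat_bits a @ nat_bits b)"
    unfolding length_nat_bits_le_iff [symmetric] by simp_all
  then show ?thesis
    using 1 [of "nat_bits a @ nat_bits b" "(a, b, s)"] 2 [of "nat_bits a @ nat_bits b" "(a, b, s)"]
    by (simp add: bits_fold_def)
qed

text \<open>The hypothesis on \<open>f\<close> is fixed to the instance type of the fold step,
  because a hypothesis cannot be polymorphic in a type. The constant \<open>k\<close> keeps the
  growth of the state additive.\<close>

lemma ptime_bits_fold:
  fixes es :: "'s \<Rightarrow> tree" and a b :: "'x \<Rightarrow> nat"
  assumes a: "ptime S E enc_nat a" and b: "ptime S E enc_nat b" and s: "ptime S E es s"
    and f: "\<And>S E p q (s :: 'x \<times> bool \<times> nat \<times> nat \<times> 's \<Rightarrow> 's).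
      ptime S E enc_bool p \<Longrightarrow> ptime S E enc_bool q \<Longrightarrow> ptime S E es s \<Longrightarrow>
      ptime S E es (\<lambda>x. f (p x) (q x) (s x))"
    and k: "\<And>p q s. size (es (f p q s)) \<le> size (es s) + k"
  shows "ptime S E es (\<lambda>x. bits_fold f (a x) (b x) (s x))"
proof -
  let ?enc = "enc_pair enc_nat (enc_pair enc_nat es)"
  have step: "ptime S E ?enc (\<lambda>x. bits_step f (t x))"
    if "ptime S E ?enc t" for S E and t :: "'x \<times> bool \<times> nat \<times> nat \<times> 's \<Rightarrow> nat \<times> nat \<times> 's"
    unfolding bits_step_def
    by (intro ptime_Pair ptime_div2 ptime_odd f ptime_fst [OF that] ptime_fst [OF ptime_snd [OF that]]
        ptime_snd [OF ptime_snd [OF that]])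
  have "ptime S E ?enc (\<lambda>x. fold (\<lambda>_. bits_step f) (nat_bits (a x) @ nat_bits (b x)) (a x, b x, s x))"
  proof (rule ptime_fold_incr [where ee = enc_bool and h = "\<lambda>_. k"])
    show "size (?enc (bits_step f t)) \<le> size (?enc t) + k" for t
      using size_enc_nat_div2 [of "fst t"] size_enc_nat_div2 [of "fst (snd t)"]
        k [of "odd (fst t)" "odd (fst (snd t))" "snd (snd t)"]
      by (simp add: enc_pair_def bits_step_def)
  qed (intro ptime_append ptime_nat_bits ptime_Pair a b s step ptime_var polybdd_const; simp)+
  from ptime_snd [OF ptime_snd [OF this]] show ?thesis by (simp add: bits_fold_def)
qed

section \<open>Comparison, addition and multiplication of natural numbers, and intervals\<close>

lemma ptime_le:
  assumes "ptime S E enc_nat a" "ptime S E enc_nat b"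
  shows "ptime S E enc_bool (\<lambda>x. a x \<le> b x)"
proof -
  \<comment> \<open>The state is the comparison of the bits read so far; a more significant bit
    overrides it if the two numbers differ there. Starting from \<open>True\<close> makes equal
    numbers satisfy the comparison.\<close>
  define f where "f p q r = (if p = q then r else q)" for p q r :: bool
  define val where "val a b r = (if a = b then r else a < b)" for a b :: nat and r
  have "val (a div 2) (b div 2) (f (odd a) (odd b) r) = val a b r" for a b r
    unfolding val_def f_def by (cases "odd a"; cases "odd b") (auto elim!: oddE evenE)
  from bits_fold_invariant [of val f, OF this]
  have *: "bits_fold f a b True \<longleftrightarrow> a \<le> b" for a b by (auto simp: val_def)
  have "ptime S E enc_bool (\<lambda>x. bits_fold f (a x) (b x) True)"
  proof (rule ptime_bits_fold [where k = 1, OF assms ptime_True])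
    show "size (enc_bool (f p q s)) \<le> size (enc_bool s) + 1" for p q s
      using size_enc_bool [of "f p q s"] by simp
  qed (unfold f_def, intro ptime_if' ptime_bool_eq)
  then show ?thesis by (simp add: *)
qed

lemma ptime_nat_eq:
  assumes "ptime S E enc_nat a" "ptime S E enc_nat b"
  shows "ptime S E enc_bool (\<lambda>x. a x = b x)"
  using ptime_conj [OF ptime_le [OF assms] ptime_le [OF assms(2,1)]] by (simp add: eq_iff)

lemma ptime_add:
  assumes "ptime S E enc_nat a" "ptime S E enc_nat b"
  shows "ptime S E enc_nat (\<lambda>x. a x + b x)"
proof -
  define horner where "horner ds n = fold (\<lambda>d n. of_bool d + 2 * n) ds n" for ds and n :: nat
  \<comment> \<open>The state consists of the carry and the bits of the sum found so far, most significant
    bit first.\<close>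
  define f where "f p q s = (if p then q \<or> fst s else q \<and> fst s, (p = (q = fst s)) # snd s)"
    for p q and s :: "bool \<times> bool list"
  \<comment> \<open>The unread parts and the carry add up to the leading part of the sum, which the
    digits found so far continue.\<close>
  define val where "val a b s = horner (snd s) (a + b + of_bool (fst s))" for a b s
  have "val (a div 2) (b div 2) (f (odd a) (odd b) s) = val a b s" for a b s
    by (cases "odd a"; cases "odd b"; cases "fst s")
      (auto simp: val_def f_def horner_def elim!: oddE evenE)
  from bits_fold_invariant [of val f, OF this]
  have *: "horner (snd (bits_fold f a b (False, []))) (of_bool (fst (bits_fold f a b (False, [])))) = a + b"
    for a b by (simp add: val_def horner_def)
  let ?enc = "enc_pair enc_bool (enc_list enc_bool)"
  have s: "ptime S E ?enc (\<lambda>x. bits_fold f (a x) (b x) (False, []))"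
  proof (rule ptime_bits_fold [where k = 3, OF assms ptime_const])
    show "size (?enc (f p q s)) \<le> size (?enc s) + 3" for p q s
      using size_enc_bool [of "fst (f p q s)"] size_enc_bool [of "p = (q = fst s)"]
      by (simp add: enc_pair_def f_def)
    show "ptime S E ?enc (\<lambda>x. f (p x) (q x) (s x))"
      if "ptime S E enc_bool p" "ptime S E enc_bool q" "ptime S E ?enc s" for S E p q
        and s :: "'a \<times> bool \<times> nat \<times> nat \<times> bool \<times> bool list \<Rightarrow> bool \<times> bool list"
      unfolding f_def
      by (intro ptime_Pair ptime_Cons ptime_if' ptime_disj ptime_conj ptime_bool_eq that
          ptime_fst [OF that(3)] ptime_snd [OF that(3)])
  qed
  \<comment> \<open>The final carry is the leading digit. The addend \<open>2 * 0\<close> gives it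
    the form treated by \<open>ptime_bit\<close>.\<close>
  have "ptime S E enc_nat (\<lambda>x. fold (\<lambda>d n. of_bool d + 2 * n) (snd (bits_fold f (a x) (b x) (False, [])))
      (of_bool (fst (bits_fold f (a x) (b x) (False, []))) + 2 * 0))"
  proof (rule ptime_fold_incr [where ee = enc_bool and h = "\<lambda>_. 2"])
    show "size (enc_nat (of_bool d + 2 * n)) \<le> size (enc_nat n) + 2" for d n
      using size_enc_bool [of d] by (simp add: enc_nat_bit)
    show "ptime S E enc_nat (\<lambda>x. of_bool (fst (bits_fold f (a x) (b x) (False, []))) + 2 * 0)"
      by (rule ptime_bit [OF ptime_fst [OF s] ptime_const])
  qed (intro ptime_snd [OF s] ptime_bit ptime_var polybdd_const; simp)+
  then show ?thesis using * by (simp add: horner_def)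
qed

lemma ptime_mult:
  assumes a: "ptime S E enc_nat a" and b: "ptime S E enc_nat b"
  shows "ptime S E enc_nat (\<lambda>x. a x * b x)"
proof -
  \<comment> \<open>Multiplication by Horner's scheme; doubling is written as appending the bit
    \<open>False\<close>, so that \<open>ptime_bit\<close> applies.\<close>
  define horner where "horner m ds = foldr (\<lambda>d n. (if d then m else 0) + (of_bool False + 2 * n)) ds 0"
    for m :: nat and ds
  have horner_mult: "horner m ds = horner 1 ds * m" for m ds
    unfolding horner_def by (induction ds) (auto simp: algebra_simps)
  have horner_bits: "horner 1 (nat_bits n) = n" for n
  proof (induction n rule: nat_bits.induct)
    case (1 n)
    then show ?case
      by (cases "n = 0") (auto simp: nat_bits_pos horner_def elim!: oddE evenE)
  qed
  have horner_suffix: "horner 1 vs \<le> horner 1 (us @ vs)" for us vs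
    unfolding horner_def by (induction us) auto
  have "ptime S E enc_nat (\<lambda>x. fold (\<lambda>d n. (if d then b x else 0) + (of_bool False + 2 * n))
      (rev (nat_bits (a x))) 0)"
  proof (rule ptime_fold [where ee = enc_bool
        and h = "\<lambda>x. 2 * (size (enc_nat (a x)) + size (enc_nat (b x)))"])
    show "size (enc_nat (fold (\<lambda>d n. (if d then b x else 0) + (of_bool False + 2 * n)) ys 0))
        \<le> 2 * (size (enc_nat (a x)) + size (enc_nat (b x)))"
      if "rev (nat_bits (a x)) = ys @ zs" for x ys zs
    proof -
      \<comment> \<open>Bits are stored with the least significant one first, so
        \<open>rev ys\<close> consists of the leading digits of \<open>a x\<close>. Hence no
        intermediate result exceeds the final product.\<close>
      have "nat_bits (a x) = rev zs @ rev ys" using arg_cong [OF that, of rev] by simp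
      then have "horner 1 (rev ys) \<le> a x" using horner_suffix [of "rev ys" "rev zs"] horner_bits [of "a x"]
        by simp
      then have "horner (b x) (rev ys) \<le> a x * b x" by (simp add: horner_mult [of "b x"])
      then have "length (nat_bits (horner (b x) (rev ys))) \<le> length (nat_bits (a x)) + length (nat_bits (b x))"
        using length_nat_bits_mono length_nat_bits_mult le_trans by blast
      moreover have "fold (\<lambda>d n. (if d then b x else 0) + (of_bool False + 2 * n)) ys 0
          = horner (b x) (rev ys)"
        by (simp add: horner_def foldr_conv_fold)
      ultimately show ?thesis
        using size_enc_nat [of "horner (b x) (rev ys)"] length_le_size_enc_nat [of "a x"]
          length_le_size_enc_nat [of "b x"] by simp
    qed
    show "polybdd S E (\<lambda>x. 2 * (size (enc_nat (a x)) + size (enc_nat (b x))))"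
      by (intro polybdd_mult polybdd_const polybdd_add ptime_size a b)
  next
    let ?S = "{(x, d, n). x \<in> S \<and> (\<exists>ys zs. rev (nat_bits (a x)) = ys @ d # zs \<and>
      n = fold (\<lambda>d n. (if d then b x else 0) + (of_bool False + 2 * n)) ys 0)}"
    show "ptime ?S ((\<lambda>z. enc_bool (fst (snd z))) # (\<lambda>z. enc_nat (snd (snd z))) # lift_env E) enc_nat
        (\<lambda>z. (if fst (snd z) then b (fst z) else 0) + (of_bool False + 2 * snd (snd z)))"
      by (rule ptime_add [OF ptime_if' [OF _ ptime_lift2 [OF b] ptime_const] ptime_bit [OF ptime_False]])
        (auto intro: ptime_var)
  qed (intro ptime_rev ptime_nat_bits a ptime_const)+
  then show ?thesis
    unfolding foldr_conv_fold [symmetric] horner_def [symmetric] horner_mult [of "b _"] horner_bits .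
qed

lemma ptime_length:
  assumes "ptime S E (enc_list ee) xs"
  shows "ptime S E enc_nat (\<lambda>x. length (xs x))"
proof -
  have *: "fold (\<lambda>_ n. n + 1) ys k = k + length ys" for ys :: "'b list" and k :: nat
    by (induction ys arbitrary: k) auto
  have "ptime S E enc_nat (\<lambda>x. fold (\<lambda>_ n. n + 1) (xs x) 0)"
  proof (rule ptime_fold [OF assms])
    show "size (enc_nat (fold (\<lambda>_ n. n + 1) ys 0)) \<le> 2 * size (enc_list ee (xs x))"
      if "xs x = ys @ zs" for x ys zs
    proof -
      have "length ys \<le> size (enc_list ee (xs x))"
        using length_le_size_enc_list [of "xs x" ee] that by simp
      then show ?thesis unfolding * by (intro size_enc_nat_le) simp
    qed
    show "polybdd S E (\<lambda>x. 2 * size (enc_list ee (xs x)))"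
      by (intro polybdd_mult polybdd_const ptime_size assms)
  qed (intro ptime_add ptime_const ptime_var; simp)+
  then show ?thesis unfolding * by simp
qed

text \<open>The end of an interval is given in unary, as the length of a list, since the interval up
  to a binary number can be exponentially large.\<close>

lemma ptime_upt_length:
  assumes "ptime S E (enc_list ee) xs"
  shows "ptime S E (enc_list enc_nat) (\<lambda>x. [0..<length (xs x)])"
proof -
  have map_Suc: "0 # map (\<lambda>n. n + 1) [0..<k] = [0..<Suc k]" for k
    by (simp add: map_Suc_upt upt_conv_Cons del: upt_Suc)
  have *: "fold (\<lambda>_ ns. 0 # map (\<lambda>n. n + 1) ns) ys [0..<k] = [0..<k + length ys]" for ys :: "'b list" and k :: nat
    by (induction ys arbitrary: k) (simp, simp only: fold_Cons o_apply map_Suc list.size add_Suc_right add_Suc add_0_right)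
  have *: "fold (\<lambda>_ ns. 0 # map (\<lambda>n. n + 1) ns) ys [] = [0..<length ys]" for ys :: "'b list"
    using * [of ys 0] by simp
  have "ptime S E (enc_list enc_nat) (\<lambda>x. fold (\<lambda>_ ns. 0 # map (\<lambda>n. n + 1) ns) (xs x) [])"
  proof (rule ptime_fold [OF assms ptime_Nil])
    let ?s = "\<lambda>x. size (enc_list ee (xs x))"
    show "size (enc_list enc_nat (fold (\<lambda>_ ns. 0 # map (\<lambda>n. n + 1) ns) ys []))
        \<le> ?s x * (1 + 2 * ?s x)"
      if "xs x = ys @ zs" for x ys zs
    proof -
      have 1: "length ys \<le> ?s x"
        using length_le_size_enc_list [of "xs x" ee] that by simp
      have "size (enc_list enc_nat [0..<length ys]) \<le> (\<Sum>n\<leftarrow>[0..<length ys]. 1 + 2 * ?s x)"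
        unfolding size_enc_list [of enc_nat]
        by (rule sum_list_mono) (use 1 in \<open>auto intro!: size_enc_nat_le\<close>)
      also have "\<dots> = length ys * (1 + 2 * ?s x)" by (simp add: sum_list_triv)
      also have "\<dots> \<le> ?s x * (1 + 2 * ?s x)" using 1 by (rule mult_le_mono1)
      finally show ?thesis unfolding * .
    qed
    show "polybdd S E (\<lambda>x. ?s x * (1 + 2 * ?s x))"
      by (intro polybdd_mult polybdd_add polybdd_const ptime_size assms)
  qed (intro ptime_Cons ptime_const ptime_map [where ee = enc_nat] ptime_add ptime_var; simp)
  then show ?thesis unfolding * .
qed

section \<open>Comparison of rational numbers\<close>

definition rat_num :: "rat \<Rightarrow> int" where
  "rat_num r = fst (quotient_of r)"

definition rat_den :: "rat \<Rightarrow> int" where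
  "rat_den r = snd (quotient_of r)"

lemma enc_rat_eq: "enc_rat r =
    Node (Node (enc_bool (rat_num r < 0)) (enc_nat (nat \<bar>rat_num r\<bar>))) (enc_nat (nat (rat_den r)))"
  by (simp add: enc_rat_def enc_int_def rat_num_def rat_den_def split: prod.split)

lemma ptime_rat_le:
  assumes r: "ptime S E enc_rat r" and s: "ptime S E enc_rat s"
  shows "ptime S E enc_bool (\<lambda>x. r x \<le> s x)"
proof -
  have neg: "ptime S E enc_bool (\<lambda>x. rat_num (r x) < 0)"
    and num: "ptime S E enc_nat (\<lambda>x. nat \<bar>rat_num (r x)\<bar>)"
    and den: "ptime S E enc_nat (\<lambda>x. nat (rat_den (r x)))" if "ptime S E enc_rat r" for r
  proof -
    have "polytime S E (\<lambda>x. enc_rat (r x))" using that by (simp add: ptime_def)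
    from polytime_left [OF polytime_left [OF this]] polytime_right [OF polytime_left [OF this]]
      polytime_right [OF this]
    show "ptime S E enc_bool (\<lambda>x. rat_num (r x) < 0)"
      "ptime S E enc_nat (\<lambda>x. nat \<bar>rat_num (r x)\<bar>)"
      "ptime S E enc_nat (\<lambda>x. nat (rat_den (r x)))"
      by (simp_all add: ptime_def enc_rat_eq)
  qed
  have pos: "rat_den r > 0" for r
    unfolding rat_den_def by (metis quotient_of_denom_pos prod.collapse)
  have le: "r \<le> s \<longleftrightarrow> rat_num r * rat_den s \<le> rat_num s * rat_den r" for r s
    by (simp add: rat_less_eq_code rat_num_def rat_den_def mult.commute split: prod.split)
  \<comment> \<open>Only natural numbers can be compared so far. The signs are therefore split off
    from the cross products, and the comparison is reversed if both are negative.\<close>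
  have "r \<le> s \<longleftrightarrow>
    (if rat_num r < 0
     then if rat_num s < 0
       then nat \<bar>rat_num s\<bar> * nat (rat_den r) \<le> nat \<bar>rat_num r\<bar> * nat (rat_den s) else True
     else if rat_num s < 0 then False
       else nat \<bar>rat_num r\<bar> * nat (rat_den s) \<le> nat \<bar>rat_num s\<bar> * nat (rat_den r))" for r s
  proof -
    have nat: "nat a * nat b \<le> nat c * nat d \<longleftrightarrow> a * b \<le> c * d"
      if "a \<ge> 0" "b > 0" "c \<ge> 0" "d > 0" for a b c d
      using that by (simp add: nat_mult_distrib [symmetric] nat_le_eq_zle)
    consider "rat_num r < 0" "rat_num s < 0" | "rat_num r < 0" "rat_num s \<ge> 0"
      | "rat_num r \<ge> 0" "rat_num s < 0" | "rat_num r \<ge> 0" "rat_num s \<ge> 0" by linarith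
    then show ?thesis
    proof cases
      case 1
      then show ?thesis by (simp add: le nat pos)
    next
      case 2
      then have "rat_num r * rat_den s \<le> 0" "0 \<le> rat_num s * rat_den r"
        using pos [of r] pos [of s] by (simp_all add: mult_le_0_iff)
      with 2 show ?thesis by (simp add: le)
    next
      case 3
      then have "0 \<le> rat_num r * rat_den s" "rat_num s * rat_den r < 0"
        using pos [of r] pos [of s] by (simp_all add: mult_less_0_iff)
      with 3 show ?thesis by (simp add: le)
    next
      case 4
      then show ?thesis by (simp add: le nat pos)
    qed
  qed
  then show ?thesis
    by (simp only:) (intro ptime_if' ptime_le ptime_mult ptime_True ptime_False neg num den r s)
qed

section \<open>The construction on numbered automata\<close>

type_synonym ntrans = "nat \<times> nat \<times> rat \<times> nat"

definition src :: "ntrans \<Rightarrow> nat" where "src t = fst t"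
definition ltr :: "ntrans \<Rightarrow> nat" where "ltr t = fst (snd t)"
definition wgt :: "ntrans \<Rightarrow> rat" where "wgt t = fst (snd (snd t))"
definition tgt :: "ntrans \<Rightarrow> nat" where "tgt t = snd (snd (snd t))"

text \<open>Transitions are counted with multiplicity, so the weights need neither sorting nor
  removal of duplicates.\<close>

definition rank :: "ntrans list \<Rightarrow> rat \<Rightarrow> nat" where
  "rank ts x = length (filter (\<lambda>t. wgt t \<le> x) ts)"

text \<open>Filtering the states, instead of adding successors to \<open>R\<close>, bounds the
  result by \<open>qs\<close>. Membership is written as a bounded search, to which
  \<open>ptime_bex\<close> applies.\<close>

definition reach_step :: "nat list \<Rightarrow> ntrans list \<Rightarrow> nat list \<Rightarrow> nat list" where
  "reach_step qs ts R = filter (\<lambda>q. (\<exists>r\<in>set R. r = q) \<or>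
     (\<exists>t\<in>set ts. (\<exists>r\<in>set R. r = src t) \<and> tgt t = q)) qs"

text \<open>The list \<open>ts\<close> only counts the rounds: a reachable state is reached by a
  path with at most as many steps as there are transitions.\<close>

definition reach :: "nat list \<Rightarrow> ntrans list \<Rightarrow> nat \<Rightarrow> nat list" where
  "reach qs ts q = fold (\<lambda>_. reach_step qs ts) ts [q]"

definition reach_weights :: "nat list \<Rightarrow> ntrans list \<Rightarrow> nat \<Rightarrow> rat list" where
  "reach_weights qs ts q = map wgt (filter (\<lambda>t. \<exists>r\<in>set (reach qs ts q). r = src t) ts)"

text \<open>If \<open>j\<close> is the rank of \<open>m\<close>, then the weights of rank at most
  \<open>j\<close> are those up to \<open>m\<close>, and the greatest of them is \<open>m\<close>
  itself. So this is \<open>max m (top q)\<close>, with the weight \<open>x\<close> just taken as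
  the seed of the maximum.\<close>

definition safe_weight :: "nat list \<Rightarrow> ntrans list \<Rightarrow> nat \<Rightarrow> nat \<Rightarrow> rat \<Rightarrow> rat" where
  "safe_weight qs ts j q x =
     fold max (filter (\<lambda>y. rank ts y \<le> j) (map wgt ts) @ reach_weights qs ts q) x"

text \<open>If \<open>j\<close> is the rank of \<open>m\<close>, then the test expresses
  \<open>m \<ge> top q\<close>, and the maximum over all weights is \<open>W\<close>.\<close>

definition live_weight :: "nat list \<Rightarrow> ntrans list \<Rightarrow> nat \<Rightarrow> nat \<Rightarrow> rat \<Rightarrow> rat" where
  "live_weight qs ts j q x =
     (if \<forall>y\<in>set (reach_weights qs ts q). rank ts y \<le> j then fold max (map wgt ts) x else x)"

text \<open>The pair of a level \<open>j\<close>, the rank of the greatest weight seen so far, and a state \<open>q\<close> is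
  numbered \<open>j * length qs + q\<close>. Level 0 means that no weight has been seen.\<close>

definition level_trans :: "(nat \<Rightarrow> nat \<Rightarrow> rat \<Rightarrow> rat) \<Rightarrow> nat list \<Rightarrow> ntrans list \<Rightarrow> nat \<Rightarrow> ntrans \<Rightarrow> ntrans" where
  "level_trans W qs ts j t =
     (j * length qs + src t, ltr t, W (max j (rank ts (wgt t))) (tgt t) (wgt t),
      max j (rank ts (wgt t)) * length qs + tgt t)"

text \<open>The dummy entry in front of \<open>ts\<close> lengthens the interval by one, so that the
  levels range from 0 to \<open>length ts\<close>.\<close>

definition levels :: "ntrans list \<Rightarrow> nat list" where
  "levels ts = [0..<length ((0, 0, 0, 0) # ts)]"

text \<open>One copy of \<open>qs\<close> per level provides the number of product states in
  unary.\<close>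

definition level_states :: "nat list \<Rightarrow> ntrans list \<Rightarrow> nat list" where
  "level_states qs ts = [0..<length (concat (map (\<lambda>_. qs) (levels ts)))]"

definition product_trans :: "(nat list \<Rightarrow> ntrans list \<Rightarrow> nat \<Rightarrow> nat \<Rightarrow> rat \<Rightarrow> rat) \<Rightarrow>
    nat list \<Rightarrow> ntrans list \<Rightarrow> ntrans list" where
  "product_trans W qs ts = concat (map (\<lambda>j. map (level_trans (W qs ts) qs ts j) ts) (levels ts))"

section \<open>The construction takes polynomial time\<close>

definition enc_ntrans :: "ntrans \<Rightarrow> tree" where
  "enc_ntrans = enc_trans (\<lambda>n. n) (\<lambda>n. n)"

lemma enc_ntrans_eq: "enc_ntrans = enc_pair enc_nat (enc_pair enc_nat (enc_pair enc_rat enc_nat))"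
  by (auto simp: enc_ntrans_def enc_trans_def enc_pair_def fun_eq_iff)

lemma ptime_src: "ptime S E enc_ntrans t \<Longrightarrow> ptime S E enc_nat (\<lambda>x. src (t x))"
  and ptime_ltr: "ptime S E enc_ntrans t \<Longrightarrow> ptime S E enc_nat (\<lambda>x. ltr (t x))"
  and ptime_wgt: "ptime S E enc_ntrans t \<Longrightarrow> ptime S E enc_rat (\<lambda>x. wgt (t x))"
  and ptime_tgt: "ptime S E enc_ntrans t \<Longrightarrow> ptime S E enc_nat (\<lambda>x. tgt (t x))"
proof -
  assume "ptime S E enc_ntrans t"
  then have t: "ptime S E (enc_pair enc_nat (enc_pair enc_nat (enc_pair enc_rat enc_nat))) t"
    by (simp add: enc_ntrans_eq)
  show "ptime S E enc_nat (\<lambda>x. src (t x))" "ptime S E enc_nat (\<lambda>x. ltr (t x))"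
    "ptime S E enc_rat (\<lambda>x. wgt (t x))" "ptime S E enc_nat (\<lambda>x. tgt (t x))"
    unfolding src_def ltr_def wgt_def tgt_def
    by (rule ptime_fst [OF t] ptime_fst [OF ptime_snd [OF t]]
        ptime_fst [OF ptime_snd [OF ptime_snd [OF t]]]
        ptime_snd [OF ptime_snd [OF ptime_snd [OF t]]])+
qed

lemma fst_elems [simp]: "fst ` elems S xs \<subseteq> S"
  by (auto simp: elems_def)

lemma ptime_max:
  "ptime S E enc_nat a \<Longrightarrow> ptime S E enc_nat b \<Longrightarrow> ptime S E enc_nat (\<lambda>x. max (a x) (b x))"
  unfolding max_def by (intro ptime_if' ptime_le)

lemma ptime_fold_max:
  assumes xs: "ptime S E (enc_list enc_rat) xs" and y: "ptime S E enc_rat y"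
  shows "ptime S E enc_rat (\<lambda>x. fold max (xs x) (y x))"
proof (rule ptime_fold_inv [OF assms, where Inv = "\<lambda>x b. b = y x \<or> b \<in> set (xs x)"
      and h = "\<lambda>x. size (enc_rat (y x)) + size (enc_list enc_rat (xs x))"])
  show "size (enc_rat b) \<le> size (enc_rat (y x)) + size (enc_list enc_rat (xs x))"
    if "b = y x \<or> b \<in> set (xs x)" for b x
    using that size_elem_enc_list [of b "xs x" enc_rat] by auto
  show "polybdd S E (\<lambda>x. size (enc_rat (y x)) + size (enc_list enc_rat (xs x)))"
    by (intro polybdd_add ptime_size assms)
qed (unfold max_def, (intro ptime_if' ptime_rat_le ptime_var; simp), auto)

lemma ptime_rank:
  assumes "ptime S E (enc_list enc_ntrans) ts" "ptime S E enc_rat x"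
  shows "ptime S E enc_nat (\<lambda>d. rank (ts d) (x d))"
  unfolding rank_def
  by (intro ptime_length [where ee = enc_ntrans] ptime_filter ptime_rat_le ptime_wgt
      ptime_lift1 [OF assms(2)] assms(1) ptime_var; simp)

lemma ptime_mem:
  assumes "ptime S E (enc_list enc_nat) R" "ptime S E enc_nat q"
  shows "ptime S E enc_bool (\<lambda>d. \<exists>r\<in>set (R d). r = q d)"
  by (intro ptime_bex [where ee = enc_nat] ptime_nat_eq ptime_lift1 [OF assms(2)] assms(1) ptime_var; simp)

lemma ptime_reach_step:
  assumes "ptime S E (enc_list enc_nat) qs" "ptime S E (enc_list enc_ntrans) ts"
    "ptime S E (enc_list enc_nat) R"
  shows "ptime S E (enc_list enc_nat) (\<lambda>d. reach_step (qs d) (ts d) (R d))"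
  unfolding reach_step_def
  by (intro ptime_filter ptime_disj ptime_mem ptime_bex [where ee = enc_ntrans] ptime_conj
      ptime_nat_eq ptime_src ptime_tgt assms(1) ptime_lift1 [OF assms(2)]
      ptime_lift1 [OF assms(3)] ptime_lift1 [OF ptime_lift1 [OF assms(3) fst_elems] fst_elems] ptime_var; simp)

lemma size_enc_list_filter: "size (enc_list ee (filter P xs)) \<le> size (enc_list ee xs)"
  by (induction xs) auto

lemma ptime_reach:
  assumes qs: "ptime S E (enc_list enc_nat) qs" and ts: "ptime S E (enc_list enc_ntrans) ts"
    and q: "ptime S E enc_nat q"
  shows "ptime S E (enc_list enc_nat) (\<lambda>d. reach (qs d) (ts d) (q d))"
  unfolding reach_def
\<comment> \<open>After the start list \<open>[q]\<close>, every accumulator is a filtered version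
  of \<open>qs\<close>; the sum of the two sizes covers both cases.\<close>
proof (rule ptime_fold_inv [OF ts ptime_Cons [OF q ptime_Nil],
      where Inv = "\<lambda>d R. size (enc_list enc_nat R) \<le> size (enc_list enc_nat [q d]) + size (enc_list enc_nat (qs d))"])
  show "size (enc_list enc_nat (reach_step (qs d) (ts d) R))
    \<le> size (enc_list enc_nat [q d]) + size (enc_list enc_nat (qs d))" for d R
    unfolding reach_step_def using size_enc_list_filter trans_le_add2 by blast
  show "polybdd S E (\<lambda>d. size (enc_list enc_nat [q d]) + size (enc_list enc_nat (qs d)))"
    by (intro polybdd_add ptime_size qs ptime_Cons q ptime_Nil)
qed (intro ptime_reach_step ptime_lift2 [OF qs] ptime_lift2 [OF ts] ptime_var, auto)

lemma ptime_reach_weights: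
  assumes "ptime S E (enc_list enc_nat) qs" "ptime S E (enc_list enc_ntrans) ts"
    "ptime S E enc_nat q"
  shows "ptime S E (enc_list enc_rat) (\<lambda>d. reach_weights (qs d) (ts d) (q d))"
  unfolding reach_weights_def
  by (intro ptime_map [where ee = enc_ntrans] ptime_filter ptime_mem ptime_src ptime_wgt
      assms(2) ptime_lift1 [OF ptime_reach [OF assms]] ptime_var; simp)

lemma ptime_weights:
  assumes "ptime S E (enc_list enc_ntrans) ts"
  shows "ptime S E (enc_list enc_rat) (\<lambda>d. map wgt (ts d))"
  by (intro ptime_map [where ee = enc_ntrans] ptime_wgt assms ptime_var; simp)

lemma ptime_safe_weight:
  assumes "ptime S E (enc_list enc_nat) qs" "ptime S E (enc_list enc_ntrans) ts"
    "ptime S E enc_nat j" "ptime S E enc_nat q" "ptime S E enc_rat x"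
  shows "ptime S E enc_rat (\<lambda>d. safe_weight (qs d) (ts d) (j d) (q d) (x d))"
  unfolding safe_weight_def
  by (intro ptime_fold_max ptime_append ptime_filter ptime_weights ptime_reach_weights ptime_le
      ptime_rank assms ptime_lift1 [OF assms(2)] ptime_lift1 [OF assms(3)] ptime_var; simp)

lemma ptime_live_weight:
  assumes "ptime S E (enc_list enc_nat) qs" "ptime S E (enc_list enc_ntrans) ts"
    "ptime S E enc_nat j" "ptime S E enc_nat q" "ptime S E enc_rat x"
  shows "ptime S E enc_rat (\<lambda>d. live_weight (qs d) (ts d) (j d) (q d) (x d))"
  unfolding live_weight_def
  by (intro ptime_if' ptime_ball [where ee = enc_rat] ptime_fold_max ptime_weights
      ptime_reach_weights ptime_le
      ptime_rank assms ptime_lift1 [OF assms(2)] ptime_lift1 [OF assms(3)] ptime_var; simp)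

lemma ptime_levels:
  "ptime S E (enc_list enc_ntrans) ts \<Longrightarrow> ptime S E (enc_list enc_nat) (\<lambda>d. levels (ts d))"
  unfolding levels_def by (intro ptime_upt_length [where ee = enc_ntrans] ptime_Cons ptime_const)

lemma ptime_level_states:
  assumes "ptime S E (enc_list enc_nat) qs" "ptime S E (enc_list enc_ntrans) ts"
  shows "ptime S E (enc_list enc_nat) (\<lambda>d. level_states (qs d) (ts d))"
  unfolding level_states_def
  by (intro ptime_upt_length [where ee = enc_nat] ptime_concat_map [where ee = enc_nat]
      ptime_levels assms(2) ptime_lift1 [OF assms(1)]; simp)

lemma ptime_product_trans:
  fixes qs :: "'x \<Rightarrow> nat list"
  assumes qs: "ptime S E (enc_list enc_nat) qs" and ts: "ptime S E (enc_list enc_ntrans) ts"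
    and W: "\<And>S E qs ts j q (x :: ('x \<times> nat) \<times> ntrans \<Rightarrow> rat).
      ptime S E (enc_list enc_nat) qs \<Longrightarrow> ptime S E (enc_list enc_ntrans) ts \<Longrightarrow>
      ptime S E enc_nat j \<Longrightarrow> ptime S E enc_nat q \<Longrightarrow> ptime S E enc_rat x \<Longrightarrow>
      ptime S E enc_rat (\<lambda>d. W (qs d) (ts d) (j d) (q d) (x d))"
  shows "ptime S E (enc_list enc_ntrans) (\<lambda>d. product_trans W (qs d) (ts d))"
proof -
  have "ptime S' E' enc_ntrans (\<lambda>d. level_trans (W (qs d) (ts d)) (qs d) (ts d) (j d) (t d))"
    if "ptime S' E' (enc_list enc_nat) qs" "ptime S' E' (enc_list enc_ntrans) ts"
      "ptime S' E' enc_nat j" "ptime S' E' enc_ntrans t"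
    for S' E' qs ts j and t :: "('x \<times> nat) \<times> ntrans \<Rightarrow> ntrans"
    unfolding level_trans_def
    by (subst enc_ntrans_eq, intro ptime_Pair W that ptime_max ptime_rank ptime_src ptime_tgt
        ptime_wgt ptime_ltr ptime_add ptime_mult ptime_length [where ee = enc_nat])
  note * = this
  show ?thesis
    unfolding product_trans_def
    by (intro ptime_concat_map [where ee = enc_nat] ptime_map [where ee = enc_ntrans] *
        ptime_levels ts ptime_lift1 [OF ts] ptime_lift1 [OF ptime_lift1 [OF ts fst_elems] fst_elems]
        ptime_lift1 [OF ptime_lift1 [OF qs fst_elems] fst_elems] ptime_var; simp)
qed

section \<open>From input trees to output trees\<close>

definition aut_tree :: "nat list \<Rightarrow> nat list \<Rightarrow> nat \<Rightarrow> ntrans list \<Rightarrow> tree" where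
  "aut_tree ls qs i ts = Node (enc_list enc_nat ls)
     (Node (enc_list enc_nat qs) (Node (enc_nat i) (enc_list enc_ntrans ts)))"

text \<open>The initial state is paired with level 0, and \<open>0 * length qs + i\<close> is again
  \<open>i\<close>.\<close>

definition product_tree :: "(nat list \<Rightarrow> ntrans list \<Rightarrow> nat \<Rightarrow> nat \<Rightarrow> rat \<Rightarrow> rat) \<Rightarrow>
    nat list \<Rightarrow> nat list \<Rightarrow> nat \<Rightarrow> ntrans list \<Rightarrow> tree" where
  "product_tree W ls qs i ts = aut_tree ls (level_states qs ts) i (product_trans W qs ts)"

text \<open>The entry point has to be function 0, so the main expression is put in front and all
  calls are shifted by one.\<close>

lemma polytime_program:
  assumes "polytime UNIV [inp] outp"
  obtains P p where "\<And>d. \<exists>t\<le>poly p (size (inp d)). computes_in P (inp d) (outp d) t"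
proof -
  obtain P e T where T: "polybdd UNIV [inp] T"
    and ev: "\<And>d. d \<in> UNIV \<Longrightarrow> \<exists>t\<le>T d. eval P (env [inp] d) e (outp d) t"
    using assms by (rule polytimeE) (rule that)
  obtain p where p: "\<And>d. T d \<le> poly p (size (inp d))"
    using T by (auto simp: polybdd_def)
  have "\<exists>t\<le>poly p (size (inp d)). computes_in (shift 1 e # map (shift 1) P) (inp d) (outp d) t" for d
  proof -
    obtain t where "t \<le> T d" "eval P [inp d] e (outp d) t" using ev [of d] by auto
    moreover from this(2) have "eval (shift 1 e # map (shift 1) P) [inp d] (shift 1 e) (outp d) t"
      by (rule eval_shift(1)) simp
    ultimately show ?thesis using p [of d] by (intro exI [of _ t]) (auto simp: computes_in_def)
  qed
  then show ?thesis by (rule that)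
qed

lemma product_program:
  obtains P p where "\<And>ls qs i ts. \<exists>t\<le>poly p (size (aut_tree ls qs i ts)).
    computes_in P (aut_tree ls qs i ts)
      (Node (product_tree safe_weight ls qs i ts) (product_tree live_weight ls qs i ts)) t"
proof -
  define inp where "inp = (\<lambda>(ls, qs, i, ts). aut_tree ls qs i ts)"
  define ls :: "nat list \<times> nat list \<times> nat \<times> ntrans list \<Rightarrow> nat list" where "ls = fst"
  define qs :: "nat list \<times> nat list \<times> nat \<times> ntrans list \<Rightarrow> nat list" where "qs d = fst (snd d)" for d
  define i :: "nat list \<times> nat list \<times> nat \<times> ntrans list \<Rightarrow> nat" where "i d = fst (snd (snd d))" for d
  define ts :: "nat list \<times> nat list \<times> nat \<times> ntrans list \<Rightarrow> ntrans list" where "ts d = snd (snd (snd d))" for d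
  have inp: "inp d = aut_tree (ls d) (qs d) (i d) (ts d)" for d
    by (simp add: inp_def ls_def qs_def i_def ts_def split: prod.split)
  have 0: "polytime UNIV [inp] inp" by (rule polytime_var) simp
  have ls: "ptime UNIV [inp] (enc_list enc_nat) ls"
    using polytime_left [OF 0] by (simp add: ptime_def inp aut_tree_def)
  have qs: "ptime UNIV [inp] (enc_list enc_nat) qs"
    using polytime_left [OF polytime_right [OF 0]] by (simp add: ptime_def inp aut_tree_def)
  have i: "ptime UNIV [inp] enc_nat i"
    using polytime_left [OF polytime_right [OF polytime_right [OF 0]]]
    by (simp add: ptime_def inp aut_tree_def)
  have ts: "ptime UNIV [inp] (enc_list enc_ntrans) ts"
    using polytime_right [OF polytime_right [OF polytime_right [OF 0]]]
    by (simp add: ptime_def inp aut_tree_def)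
  have "polytime UNIV [inp] (\<lambda>d. Node (product_tree safe_weight (ls d) (qs d) (i d) (ts d))
      (product_tree live_weight (ls d) (qs d) (i d) (ts d)))"
    unfolding product_tree_def aut_tree_def
    by (intro polytime_Node ls [unfolded ptime_def] i [unfolded ptime_def]
        ptime_level_states [OF qs ts, unfolded ptime_def]
        ptime_product_trans [OF qs ts ptime_safe_weight, unfolded ptime_def]
        ptime_product_trans [OF qs ts ptime_live_weight, unfolded ptime_def])
  then obtain P p where *: "\<And>d. \<exists>t\<le>poly p (size (inp d)). computes_in P (inp d)
      (Node (product_tree safe_weight (ls d) (qs d) (i d) (ts d))
        (product_tree live_weight (ls d) (qs d) (i d) (ts d))) t"
    by (rule polytime_program) (rule that)
  show ?thesis
  proof (rule that [of p P])
    fix a b c e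
    show "\<exists>t\<le>poly p (size (aut_tree a b c e)).
      computes_in P (aut_tree a b c e)
        (Node (product_tree safe_weight a b c e) (product_tree live_weight a b c e)) t"
      using * [of "(a, b, c, e)"] by (simp add: inp ls_def qs_def i_def ts_def)
  qed
qed

section \<open>Runs of deterministic automata\<close>

lemma run_state:
  assumes "quantitative_automaton A" "w \<in> omega_words (alphabet A)" "is_run A w qs xs"
  shows "qs m \<in> states A"
proof (induction m)
  case 0
  then show ?case using assms by (simp add: is_run_def quantitative_automaton_def)
next
  case (Suc m)
  have "w m \<in> alphabet A" using assms(2) by (auto simp: omega_words_def)
  then have "delta A (qs m) (w m) \<subseteq> UNIV \<times> states A"
    using assms(1) Suc by (simp add: quantitative_automaton_def)
  then show ?case using assms(3) by (auto simp: is_run_def)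
qed

lemma run_exists:
  assumes A: "quantitative_automaton A" and w: "w \<in> omega_words (alphabet A)"
  obtains qs xs where "is_run A w qs xs"
proof -
  define qs where "qs = rec_nat (initial A) (\<lambda>m q. SOME q'. \<exists>x. (x, q') \<in> delta A q (w m))"
  have qs: "qs 0 = initial A" "qs (Suc m) = (SOME q'. \<exists>x. (x, q') \<in> delta A (qs m) (w m))" for m
    by (simp_all add: qs_def)
  have step: "\<exists>x. (x, qs (Suc m)) \<in> delta A (qs m) (w m)" if "qs m \<in> states A" for m
  proof -
    have "w m \<in> alphabet A" using w by (auto simp: omega_words_def)
    then have "delta A (qs m) (w m) \<noteq> {}" using A that by (simp add: quantitative_automaton_def)
    then have "\<exists>q' x. (x, q') \<in> delta A (qs m) (w m)" by auto
    then show ?thesis unfolding qs(2) by (rule someI_ex)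
  qed
  have st: "qs m \<in> states A" for m
  proof (induction m)
    case 0
    then show ?case using A by (simp add: qs(1) quantitative_automaton_def)
  next
    case (Suc m)
    have "w m \<in> alphabet A" using w by (auto simp: omega_words_def)
    then have "delta A (qs m) (w m) \<subseteq> UNIV \<times> states A"
      using A Suc by (simp add: quantitative_automaton_def)
    then show ?case using step [OF Suc] by auto
  qed
  have "\<forall>m. \<exists>x. (x, qs (Suc m)) \<in> delta A (qs m) (w m)" using step [OF st] by blast
  then obtain xs where "\<And>m. (xs m, qs (Suc m)) \<in> delta A (qs m) (w m)"
    by (rule choice [THEN exE]) blast
  then show ?thesis by (intro that [of qs xs]) (simp add: is_run_def qs(1))
qed

text \<open>Equal words give the uniqueness of runs; words with a common prefix give what safety and
  the redirection of runs rely on.\<close>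

lemma run_agree:
  assumes A: "quantitative_automaton A" "deterministic A"
    and w: "w \<in> omega_words (alphabet A)" "is_run A w qs xs"
    and w': "w' \<in> omega_words (alphabet A)" "is_run A w' qs' xs'"
    and eq: "\<And>i. i < m \<Longrightarrow> w i = w' i"
  shows "qs m = qs' m" and "\<And>i. i < m \<Longrightarrow> xs i = xs' i"
proof -
  have det: "x = y \<and> p = q" if "(x, p) \<in> delta A r a" "(y, q) \<in> delta A r a" "r \<in> states A" "a \<in> alphabet A"
    for x y p q r a
  proof -
    have "is_singleton (delta A r a)" using A(2) that by (simp add: deterministic_def)
    then show ?thesis using that(1,2) by (auto simp: is_singleton_def)
  qed
  have "qs j = qs' j \<and> (\<forall>i<j. xs i = xs' i)" if "j \<le> m" for j
    using that
  proof (induction j)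
    case 0
    then show ?case using w(2) w'(2) by (simp add: is_run_def)
  next
    case (Suc j)
    then have "qs j = qs' j" "w j = w' j" by (simp_all add: eq)
    moreover have "w j \<in> alphabet A" using w(1) by (auto simp: omega_words_def)
    moreover have "(xs j, qs (Suc j)) \<in> delta A (qs j) (w j)"
      "(xs' j, qs' (Suc j)) \<in> delta A (qs' j) (w' j)"
      using w(2) w'(2) by (simp_all add: is_run_def)
    ultimately have "xs j = xs' j \<and> qs (Suc j) = qs' (Suc j)"
      using run_state [OF A(1) w, of j] by (intro det [of _ _ "qs j" "w j"]) simp_all
    then show ?case using Suc by (auto simp: less_Suc_eq)
  qed
  from this [OF order_refl] show "qs m = qs' m" "\<And>i. i < m \<Longrightarrow> xs i = xs' i" by blast+
qed

lemma aut_value_run: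
  assumes A: "quantitative_automaton A" "deterministic A"
    and w: "w \<in> omega_words (alphabet A)" "is_run A w qs xs"
  shows "aut_value Val A w = Val (\<lambda>i. of_rat (xs i))"
proof -
  have "xs' = xs" if "is_run A w qs' xs'" for qs' xs'
  proof
    fix m
    show "xs' m = xs m" by (rule run_agree(2) [OF A w(1) that w, of "Suc m"]) simp_all
  qed
  then have "{Val (\<lambda>i. of_rat (xs i)) | qs xs. is_run A w qs xs} = {Val (\<lambda>i. of_rat (xs i))}"
    using w(2) by blast
  then show ?thesis by (simp add: aut_value_def)
qed

text \<open>Provides the boundedness on which suprema and infima in \<open>real\<close>
  depend.\<close>

lemma finite_run_weights:
  assumes A: "quantitative_automaton A"
    and w: "w \<in> omega_words (alphabet A)" "is_run A w qs xs"
  shows "finite (range (\<lambda>i. real_of_rat (xs i)))"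
proof -
  have "range xs \<subseteq> (\<Union>q\<in>states A. \<Union>a\<in>alphabet A. fst ` delta A q a)"
  proof safe
    fix i
    have "(xs i, qs (Suc i)) \<in> delta A (qs i) (w i)" "w i \<in> alphabet A"
      using w by (auto simp: is_run_def omega_words_def)
    then show "xs i \<in> (\<Union>q\<in>states A. \<Union>a\<in>alphabet A. fst ` delta A q a)"
      using run_state [OF A w, of i] by force
  qed
  moreover have "finite (\<Union>q\<in>states A. \<Union>a\<in>alphabet A. fst ` delta A q a)"
    using A by (auto simp: quantitative_automaton_def)
  ultimately have "finite (range xs)" by (rule finite_subset)
  then have "finite (real_of_rat ` range xs)" by (rule finite_imageI)
  then show ?thesis by (simp add: image_image)
qed

lemma prefix_conc_nth: "j < m \<Longrightarrow> (prefix m w \<frown> w') j = w j"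
  by (simp add: conc_def subsequence_def)

lemma conc_in_omega_words:
  "w \<in> omega_words \<Sigma> \<Longrightarrow> w' \<in> omega_words \<Sigma> \<Longrightarrow> prefix m w \<frown> w' \<in> omega_words \<Sigma>"
  by (auto simp: omega_words_def conc_def subsequence_def image_subset_iff)

text \<open>An infimum over finitely many weights is attained, hence witnessed by a finite prefix.\<close>

lemma safe_Inf:
  assumes A: "quantitative_automaton A" "deterministic A"
  shows "safe Inf_val A"
  unfolding safe_def
proof (intro ballI allI impI)
  fix w v assume w: "w \<in> omega_words (alphabet A)" and v: "aut_value Inf_val A w < v"
  obtain qs xs where run: "is_run A w qs xs" using run_exists [OF A(1) w] .
  have "\<exists>i. of_rat (xs i) < v"
  proof (rule ccontr)
    assume "\<not> (\<exists>i. of_rat (xs i) < v)"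
    then have "v \<le> Inf_val (\<lambda>i. of_rat (xs i))"
      unfolding Inf_val_def by (intro cINF_greatest) (auto simp: not_less)
    then show False using v by (simp add: aut_value_run [OF A w run])
  qed
  then obtain i where i: "of_rat (xs i) < v" ..
  \<comment> \<open>The prefix has to include the letter \<open>w i\<close>, with which the weight
    \<open>xs i\<close> is taken.\<close>
  let ?u = "prefix (Suc i) w"
  have "aut_value Inf_val A (?u \<frown> w') \<le> of_rat (xs i)" if "w' \<in> omega_words (alphabet A)" for w'
  proof -
    have uw': "?u \<frown> w' \<in> omega_words (alphabet A)" by (rule conc_in_omega_words [OF w that])
    obtain qs' xs' where run': "is_run A (?u \<frown> w') qs' xs'" using run_exists [OF A(1) uw'] .
    have eq: "xs i = xs' i"
      by (rule run_agree(2) [OF A w run uw' run', of "Suc i"]) (simp_all only: prefix_conc_nth lessI)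
    have "aut_value Inf_val A (?u \<frown> w') = Inf_val (\<lambda>i. of_rat (xs' i))"
      by (rule aut_value_run [OF A uw' run'])
    also have "\<dots> \<le> of_rat (xs' i)"
      unfolding Inf_val_def
      by (intro cINF_lower bdd_below_finite finite_run_weights [OF A(1) uw' run']) simp
    also have "\<dots> = of_rat (xs i)" by (simp only: eq)
    finally show ?thesis .
  qed
  then have "(SUP w'\<in>omega_words (alphabet A). aut_value Inf_val A (?u \<frown> w')) \<le> of_rat (xs i)"
    using w by (intro cSUP_least) auto
  then show "\<exists>u. u \<prec> w \<and> (SUP w'\<in>omega_words (alphabet A). aut_value Inf_val A (u \<frown> w')) < v"
    using i by (intro exI [of _ ?u] conjI) (unfold strict_prefix_of_def, blast, linarith)
qed

section \<open>Numbered automata\<close>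

definition edges :: "ntrans list \<Rightarrow> (nat \<times> nat) set" where
  "edges ts = (\<lambda>t. (src t, tgt t)) ` set ts"

text \<open>After \<open>m\<close> rounds exactly the states at the end of paths with at most
  \<open>m\<close> edges have been found. In a finite relation, paths with at most as many steps as
  edges suffice, and there are at most \<open>length ts\<close> edges.\<close>

lemma set_reach:
  assumes ts: "\<And>t. t \<in> set ts \<Longrightarrow> tgt t < n" and q: "q < n"
  shows "set (reach [0..<n] ts q) = {q'. (q, q') \<in> (edges ts)\<^sup>*}"
proof -
  have step: "set (reach_step [0..<n] ts R) = set R \<union> edges ts `` set R" if "set R \<subseteq> {..<n}" for R
    using that ts by (force simp: reach_step_def edges_def)
  have fold: "set (fold (\<lambda>_. reach_step [0..<n] ts) ys R) =
      {q'. \<exists>m\<le>length ys. \<exists>r\<in>set R. (r, q') \<in> edges ts ^^ m}" if "set R \<subseteq> {..<n}" for ys :: "ntrans list" and R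
    using that
  proof (induction ys arbitrary: R)
    case (Cons y ys)
    let ?R = "reach_step [0..<n] ts R"
    have R: "set ?R = set R \<union> edges ts `` set R" by (rule step [OF Cons.prems])
    have "set ?R \<subseteq> {..<n}" by (auto simp: reach_step_def)
    from Cons.IH [OF this]
    have "set (fold (\<lambda>_. reach_step [0..<n] ts) (y # ys) R) =
        {q'. \<exists>m\<le>length ys. \<exists>r\<in>set R \<union> edges ts `` set R. (r, q') \<in> edges ts ^^ m}"
      by (simp add: R)
    also have "\<dots> = {q'. \<exists>m\<le>length (y # ys). \<exists>r\<in>set R. (r, q') \<in> edges ts ^^ m}" (is "?L = ?R'")
    proof (intro equalityI subsetI)
      fix q' assume "q' \<in> ?L"
      then obtain m r where m: "m \<le> length ys" "(r, q') \<in> edges ts ^^ m" "r \<in> set R \<union> edges ts `` set R"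
        by blast
      from m(3) show "q' \<in> ?R'"
      proof
        assume "r \<in> set R"
        then show ?thesis using m(1,2) by (auto intro: le_SucI)
      next
        assume "r \<in> edges ts `` set R"
        then obtain p where "p \<in> set R" "(p, r) \<in> edges ts" by blast
        moreover from this(2) m(2) have "(p, q') \<in> edges ts ^^ Suc m" by (rule relpow_Suc_I2)
        ultimately show ?thesis using m(1)
          by (intro CollectI exI [of _ "Suc m"] conjI bexI [of _ p]) simp_all
      qed
    next
      fix q' assume "q' \<in> ?R'"
      then obtain m r where m: "m \<le> length (y # ys)" "(r, q') \<in> edges ts ^^ m" "r \<in> set R" by blast
      show "q' \<in> ?L"
      proof (cases m)
        case 0
        then show ?thesis using m by auto
      next
        case (Suc m')
        with m(2) obtain p where "(r, p) \<in> edges ts" "(p, q') \<in> edges ts ^^ m'"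
          by (blast elim: relpow_Suc_E2)
        then show ?thesis using m Suc by auto
      qed
    qed
    finally show ?case .
  qed auto
  have fin: "finite (edges ts)" by (simp add: edges_def)
  have card: "card (edges ts) \<le> length ts"
    unfolding edges_def by (rule order_trans [OF card_image_le card_length]) simp
  have "(q, q') \<in> (edges ts)\<^sup>* \<longleftrightarrow> (\<exists>m\<le>length ts. (q, q') \<in> edges ts ^^ m)" for q'
  proof
    assume "(q, q') \<in> (edges ts)\<^sup>*"
    then obtain m where "m \<le> card (edges ts)" "(q, q') \<in> edges ts ^^ m"
      unfolding rtrancl_finite_eq_relpow [OF fin] by blast
    then show "\<exists>m\<le>length ts. (q, q') \<in> edges ts ^^ m"
      using card by (intro exI [of _ m]) simp
  next
    assume "\<exists>m\<le>length ts. (q, q') \<in> edges ts ^^ m"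
    then show "(q, q') \<in> (edges ts)\<^sup>*" by (blast intro: relpow_imp_rtrancl)
  qed
  then show ?thesis using fold [of "[q]" ts] q by (simp add: reach_def)
qed

text \<open>States become numbers, but letters keep their type, since the components must have the
  alphabet of the given automaton. Transitions refer to a letter through its number
  \<open>f a\<close>.\<close>

definition aut_of :: "('a \<Rightarrow> nat) \<Rightarrow> 'a set \<Rightarrow> nat \<Rightarrow> nat \<Rightarrow> ntrans list \<Rightarrow> ('a, nat) automaton" where
  "aut_of f \<Sigma> n i ts = \<lparr>alphabet = \<Sigma>, states = {..<n}, initial = i,
     delta = (\<lambda>q a. {(x, q'). (q, f a, x, q') \<in> set ts})\<rparr>"

lemma aut_of_simps [simp]:
  "alphabet (aut_of f \<Sigma> n i ts) = \<Sigma>" "states (aut_of f \<Sigma> n i ts) = {..<n}"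
  "initial (aut_of f \<Sigma> n i ts) = i"
  "delta (aut_of f \<Sigma> n i ts) q a = {(x, q'). (q, f a, x, q') \<in> set ts}"
  by (simp_all add: aut_of_def)

lemma is_run_aut_of: "is_run (aut_of f \<Sigma> n i ts) w qs xs \<longleftrightarrow>
    qs 0 = i \<and> (\<forall>m. (qs m, f (w m), xs m, qs (Suc m)) \<in> set ts)"
  by (simp add: is_run_def)

lemma ntrans_sel [simp]: "src (q, a, x, q') = q" "ltr (q, a, x, q') = a" "wgt (q, a, x, q') = x"
  "tgt (q, a, x, q') = q'"
  by (simp_all add: src_def ltr_def wgt_def tgt_def)

lemma ntrans_collapse: "(src t, ltr t, wgt t, tgt t) = t"
  by (simp add: src_def ltr_def wgt_def tgt_def)

text \<open>Both the renumbered input and its products satisfy these conditions, so encoding,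
  determinism and totality are treated once for all of them.\<close>

locale numbered_automaton =
  fixes f :: "'a \<Rightarrow> nat" and \<Sigma> :: "'a set" and n i :: nat and ts :: "ntrans list"
  assumes finite_alphabet: "finite \<Sigma>" and numbering: "bij_betw f \<Sigma> {..<card \<Sigma>}"
    and initial_less: "i < n" and distinct_trans: "distinct ts"
    and trans_less: "t \<in> set ts \<Longrightarrow> src t < n \<and> ltr t < card \<Sigma> \<and> tgt t < n"
    and trans_exists: "q < n \<Longrightarrow> a < card \<Sigma> \<Longrightarrow> \<exists>t\<in>set ts. src t = q \<and> ltr t = a"
    and trans_unique: "t \<in> set ts \<Longrightarrow> t' \<in> set ts \<Longrightarrow> src t = src t' \<Longrightarrow> ltr t = ltr t' \<Longrightarrow> t = t'"
begin

abbreviation "Aut \<equiv> aut_of f \<Sigma> n i ts"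

lemma letter_less: "a \<in> \<Sigma> \<Longrightarrow> f a < card \<Sigma>"
  using numbering by (auto simp: bij_betw_def)

lemma letter_exists: "c < card \<Sigma> \<Longrightarrow> \<exists>a\<in>\<Sigma>. f a = c"
proof -
  assume "c < card \<Sigma>"
  then have "c \<in> f ` \<Sigma>" using numbering by (simp add: bij_betw_def)
  then show ?thesis by blast
qed

lemma delta_singleton: "q < n \<Longrightarrow> a \<in> \<Sigma> \<Longrightarrow> \<exists>x q'. q' < n \<and> {(x, q'). (q, f a, x, q') \<in> set ts} = {(x, q')}"
proof -
  assume "q < n" "a \<in> \<Sigma>"
  then obtain t where t: "t \<in> set ts" "src t = q" "ltr t = f a"
    using trans_exists [of q "f a"] letter_less by auto
  have "{(x, q'). (q, f a, x, q') \<in> set ts} = {(wgt t, tgt t)}"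
  proof (intro equalityI subsetI; clarsimp)
    fix x q' assume "(q, f a, x, q') \<in> set ts"
    then have "(q, f a, x, q') = t" using t by (intro trans_unique) auto
    then show "x = wgt t \<and> q' = tgt t" by auto
  next
    show "(q, f a, wgt t, tgt t) \<in> set ts" using t ntrans_collapse [of t] by simp
  qed
  then show ?thesis using trans_less [OF t(1)] by auto
qed

lemma quantitative: "quantitative_automaton Aut"
  unfolding quantitative_automaton_def
proof (intro conjI ballI)
  fix q a assume "q \<in> states Aut" "a \<in> alphabet Aut"
  then obtain x q' where "q' < n" "delta Aut q a = {(x, q')}" using delta_singleton [of q a] by auto
  then show "finite (delta Aut q a)" "delta Aut q a \<noteq> {}" "delta Aut q a \<subseteq> UNIV \<times> states Aut"
    by auto
qed (simp_all add: finite_alphabet initial_less)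

lemma deterministic: "deterministic Aut"
  unfolding deterministic_def
proof (intro ballI)
  fix q a assume "q \<in> states Aut" "a \<in> alphabet Aut"
  then obtain x q' where "delta Aut q a = {(x, q')}" using delta_singleton [of q a] by auto
  then show "is_singleton (delta Aut q a)" by simp
qed

lemma represents_aut_tree: "represents f (aut_tree [0..<card \<Sigma>] [0..<n] i ts) Aut"
proof -
  \<comment> \<open>\<open>represents\<close> asks for transitions with letters, so \<open>h\<close>
    restores the letters from their numbers.\<close>
  define h where "h = (\<lambda>t. (src t, inv_into \<Sigma> f (ltr t), wgt t, tgt t))"
  have inv: "inv_into \<Sigma> f (ltr t) \<in> \<Sigma>" "f (inv_into \<Sigma> f (ltr t)) = ltr t" if "t \<in> set ts" for t
  proof -
    have "ltr t \<in> f ` \<Sigma>" using numbering trans_less [OF that] by (simp add: bij_betw_def)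
    then show "inv_into \<Sigma> f (ltr t) \<in> \<Sigma>" "f (inv_into \<Sigma> f (ltr t)) = ltr t"
      by (rule inv_into_into, rule f_inv_into_f)
  qed
  have "distinct (map h ts)"
    unfolding distinct_map
  proof (intro conjI inj_onI distinct_trans)
    fix t t' assume t: "t \<in> set ts" "t' \<in> set ts" and eq: "h t = h t'"
    from eq have *: "src t = src t'" "inv_into \<Sigma> f (ltr t) = inv_into \<Sigma> f (ltr t')"
      by (simp_all add: h_def)
    from *(2) have "ltr t = ltr t'" using inv(2) [OF t(1)] inv(2) [OF t(2)] by metis
    with t *(1) show "t = t'" by (intro trans_unique)
  qed
  moreover have "set (map h ts) = transitions Aut"
  proof (intro equalityI subsetI)
    fix y assume "y \<in> set (map h ts)"
    then obtain t where t: "t \<in> set ts" "y = h t" by auto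
    then show "y \<in> transitions Aut"
      using inv [OF t(1)] trans_less [OF t(1)] ntrans_collapse [of t]
      by (simp add: transitions_def h_def)
  next
    fix y assume "y \<in> transitions Aut"
    then obtain q a x q' where y: "y = (q, a, x, q')" "a \<in> \<Sigma>" "(q, f a, x, q') \<in> set ts"
      by (auto simp: transitions_def)
    have "inv_into \<Sigma> f (f a) = a" using numbering y(2) by (simp add: bij_betw_def)
    then have "y = h (q, f a, x, q')" by (simp add: h_def y(1))
    then show "y \<in> set (map h ts)" using y(3) by auto
  qed
  moreover have "enc_list enc_ntrans ts = enc_list (enc_trans f (\<lambda>q. q)) (map h ts)"
  proof -
    have "enc_ntrans t = enc_trans f (\<lambda>q. q) (h t)" if "t \<in> set ts" for t
    proof -
      have "enc_ntrans t = enc_ntrans (src t, ltr t, wgt t, tgt t)" by (simp add: ntrans_collapse)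
      then show ?thesis using inv(2) [OF that] by (simp add: enc_ntrans_def enc_trans_def h_def)
    qed
    then have "enc_list enc_ntrans ts' = enc_list (enc_trans f (\<lambda>q. q)) (map h ts')" if "set ts' \<subseteq> set ts" for ts'
      using that by (induction ts') auto
    then show ?thesis by simp
  qed
  moreover have "bij_betw (\<lambda>q. q) {..<n} {..<n}" by (simp add: bij_betw_def)
  ultimately show ?thesis
    unfolding represents_def aut_tree_def aut_of_simps card_lessThan
    using numbering by (intro conjI exI [of _ "\<lambda>q. q"] exI [of _ "map h ts"]) simp_all
qed

text \<open>A path in the transition graph is realised by a word letter by letter. By determinism, a
  change of the letter at position \<open>l\<close> leaves the run up to that position
  intact.\<close>

lemma run_through:
  assumes w: "w \<in> omega_words \<Sigma>" "is_run Aut w qs xs"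
    and reach: "(qs m, src t) \<in> (edges ts)\<^sup>*" and t: "t \<in> set ts"
  obtains w' qs' xs' l where "w' \<in> omega_words \<Sigma>" "is_run Aut w' qs' xs'"
    "\<And>i. i < m \<Longrightarrow> w' i = w i" "m \<le> l" "qs' l = src t" "xs' l = wgt t" "qs' (Suc l) = tgt t"
proof -
  have extend: "\<exists>w'' qs'' xs''. w'' \<in> omega_words \<Sigma> \<and> is_run Aut w'' qs'' xs'' \<and>
      (\<forall>i<l. w'' i = w' i) \<and> qs'' l = src t \<and> xs'' l = wgt t \<and> qs'' (Suc l) = tgt t"
    if w': "w' \<in> omega_words \<Sigma>" "is_run Aut w' qs' xs'" "qs' l = src t" and t: "t \<in> set ts"
    for w' qs' xs' l t
  proof -
    obtain a where a: "a \<in> \<Sigma>" "f a = ltr t" using letter_exists [of "ltr t"] trans_less [OF t] by auto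
    \<comment> \<open>The letters behind position \<open>l\<close> stay in place; the run may change
      there, and later extensions redirect it again.\<close>
    define w'' where "w'' = w'(l := a)"
    have w'': "w'' \<in> omega_words \<Sigma>" using w'(1) a by (auto simp: omega_words_def w''_def)
    then obtain qs'' xs'' where run: "is_run Aut w'' qs'' xs''"
      using run_exists [OF quantitative, of w''] by auto
    have "qs'' l = qs' l"
      using run_agree(1) [OF quantitative deterministic _ run _ w'(2), of l] w'' w'(1)
      by (simp add: w''_def)
    moreover have "(qs'' l, f (w'' l), xs'' l, qs'' (Suc l)) \<in> set ts"
      using run by (simp add: is_run_aut_of)
    ultimately have "(qs'' l, f (w'' l), xs'' l, qs'' (Suc l)) = t"
      using t a w'(3) by (intro trans_unique) (auto simp: w''_def)
    then have "qs'' l = src t" "xs'' l = wgt t" "qs'' (Suc l) = tgt t" by auto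
    then show ?thesis using w'' run
      by (intro exI [of _ w''] exI [of _ qs''] exI [of _ xs'']) (auto simp: w''_def)
  qed
  have "\<exists>w' qs' xs' l. w' \<in> omega_words \<Sigma> \<and> is_run Aut w' qs' xs' \<and> (\<forall>i<m. w' i = w i) \<and> m \<le> l \<and> qs' l = q"
    if "(qs m, q) \<in> (edges ts)\<^sup>*" for q
    using that
  proof (induction rule: rtrancl_induct)
    case base
    then show ?case using w by blast
  next
    case (step q q')
    then obtain w' qs' xs' l where 1: "w' \<in> omega_words \<Sigma>" "is_run Aut w' qs' xs'"
      "\<forall>i<m. w' i = w i" "m \<le> l" "qs' l = q" by blast
    obtain t where t: "t \<in> set ts" "src t = q" "tgt t = q'" using step(2) by (auto simp: edges_def)
    obtain w'' qs'' xs'' where "w'' \<in> omega_words \<Sigma>" "is_run Aut w'' qs'' xs''"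
      "\<forall>i<l. w'' i = w' i" "qs'' (Suc l) = q'"
      using extend [OF 1(1,2) _ t(1), of l] 1(5) t by auto
    then show ?case using 1 by (intro exI [of _ w''] exI [of _ qs''] exI [of _ xs''] exI [of _ "Suc l"]) auto
  qed
  from this [OF reach] obtain w' qs' xs' l where 1: "w' \<in> omega_words \<Sigma>" "is_run Aut w' qs' xs'"
      "\<forall>i<m. w' i = w i" "m \<le> l" "qs' l = src t" by blast
  from extend [OF 1(1,2,5) t] obtain w'' qs'' xs'' where "w'' \<in> omega_words \<Sigma>" "is_run Aut w'' qs'' xs''"
    "\<forall>i<l. w'' i = w' i" "qs'' l = src t" "xs'' l = wgt t" "qs'' (Suc l) = tgt t" by blast
  then show ?thesis using 1 by (intro that [of w'' qs'' xs'' l]) auto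
qed

end

section \<open>The product with the levels\<close>

lemma levels_eq: "levels ts = [0..<Suc (length ts)]"
  by (simp add: levels_def)

lemma level_states_eq: "level_states [0..<n] ts = [0..<Suc (length ts) * n]"
  by (simp add: level_states_def levels_eq length_concat comp_def sum_list_triv del: upt_Suc)

lemma rank_le_length: "rank ts x \<le> length ts"
  by (simp add: rank_def)

lemma rank_mono: "x \<le> y \<Longrightarrow> rank ts x \<le> rank ts y"
  unfolding rank_def by (induction ts) auto

text \<open>If \<open>y < wgt t\<close>, then \<open>t\<close> is counted in
  \<open>rank ts (wgt t)\<close> but not in \<open>rank ts y\<close>. Hence ranks reflect the order
  of the weights as well as preserving it.\<close>

lemma rank_le_iff:
  assumes "t \<in> set ts"
  shows "rank ts (wgt t) \<le> rank ts y \<longleftrightarrow> wgt t \<le> y"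
proof
  show "wgt t \<le> y" if "rank ts (wgt t) \<le> rank ts y"
  proof (rule ccontr)
    assume "\<not> wgt t \<le> y"
    then have y: "y < wgt t" by simp
    have "rank ts y < rank ts (wgt t)"
      using assms
    proof (induction ts)
      case (Cons s ts)
      then show ?case using rank_mono [of y "wgt t" ts] y by (auto simp: rank_def)
    qed simp
    then show False using that by simp
  qed
qed (rule rank_mono)

text \<open>This makes level 0 available for the start, where no weight has been seen.\<close>

lemma rank_pos: "t \<in> set ts \<Longrightarrow> rank ts (wgt t) > 0"
  by (auto simp: rank_def filter_empty_conv)

lemma set_product_trans: "set (product_trans W qs ts) =
    {level_trans (W qs ts) qs ts j t | j t. j \<le> length ts \<and> t \<in> set ts}"
  by (force simp: product_trans_def levels_eq less_Suc_eq_le simp del: upt_Suc)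

context numbered_automaton
begin

abbreviation (input) "lev W j t \<equiv> level_trans (W [0..<n] ts) [0..<n] ts j t"

lemma level_trans_sel:
  "src (lev W j t) = j * n + src t" "ltr (lev W j t) = ltr t"
  "wgt (lev W j t) = W [0..<n] ts (max j (rank ts (wgt t))) (tgt t) (wgt t)"
  "tgt (lev W j t) = max j (rank ts (wgt t)) * n + tgt t"
  by (simp_all add: level_trans_def)

lemma pair_number_eq: "p < n \<Longrightarrow> q < n \<Longrightarrow> j * n + p = j' * n + q \<longleftrightarrow> j = j' \<and> p = q"
proof -
  assume less: "p < n" "q < n"
  have "(j * n + p) div n = j" "(j * n + p) mod n = p" "(j' * n + q) div n = j'" "(j' * n + q) mod n = q"
    using less by simp_all
  then show "j * n + p = j' * n + q \<longleftrightarrow> j = j' \<and> p = q" by metis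
qed

lemma pair_number_less: "j \<le> k \<Longrightarrow> q < n \<Longrightarrow> j * n + q < Suc k * n"
proof -
  assume "j \<le> k" "q < n"
  then have "j * n \<le> k * n" by simp
  with \<open>q < n\<close> show "j * n + q < Suc k * n" unfolding mult_Suc by linarith
qed

text \<open>Yields the distinctness of the listed product transitions as well as
  determinism.\<close>

lemma level_trans_inj:
  assumes "t \<in> set ts" "t' \<in> set ts"
    "src (lev W j t) = src (lev W j' t')" "ltr (lev W j t) = ltr (lev W j' t')"
  shows "j = j' \<and> t = t'"
proof -
  have "j = j'" "src t = src t'"
    using assms pair_number_eq [of "src t" "src t'" j j'] trans_less by (simp_all add: level_trans_sel)
  moreover have "ltr t = ltr t'" using assms(4) by (simp add: level_trans_sel)
  ultimately show ?thesis using assms trans_unique by blast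
qed

text \<open>The structure of the product does not depend on its weights, so one proof serves both
  components. For totality, a state \<open>q\<close> is decoded into the level
  \<open>q div n\<close> and the state \<open>q mod n\<close>; levels that no run visits have
  transitions too.\<close>

lemma product_numbered: "numbered_automaton f \<Sigma> (Suc (length ts) * n) i (product_trans W [0..<n] ts)"
proof
  show "finite \<Sigma>" "bij_betw f \<Sigma> {..<card \<Sigma>}" by (rule finite_alphabet, rule numbering)
  show "i < Suc (length ts) * n" using initial_less by simp
  have "product_trans W [0..<n] ts = map (\<lambda>(j, t). lev W j t) (List.product (levels ts) ts)"
    by (simp add: product_trans_def product_concat_map map_concat comp_def)
  moreover have "inj_on (\<lambda>(j, t). lev W j t) (set (List.product (levels ts) ts))"
  proof (rule inj_onI, clarify)
    fix j s j' s' assume "(j, s) \<in> set (List.product (levels ts) ts)"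
      "(j', s') \<in> set (List.product (levels ts) ts)" "lev W j s = lev W j' s'"
    then show "j = j' \<and> s = s'" using level_trans_inj [of s s' W j j'] by (simp only: set_product) auto
  qed
  moreover have "distinct (List.product (levels ts) ts)"
    by (intro distinct_product distinct_trans) (simp add: levels_eq)
  ultimately show "distinct (product_trans W [0..<n] ts)" by (simp add: distinct_map)
next
  fix t assume "t \<in> set (product_trans W [0..<n] ts)"
  then obtain j s where "j \<le> length ts" "s \<in> set ts" "t = lev W j s"
    by (auto simp: set_product_trans)
  then show "src t < Suc (length ts) * n \<and> ltr t < card \<Sigma> \<and> tgt t < Suc (length ts) * n"
    using trans_less [of s] pair_number_less [of j "length ts" "src s"] rank_le_length [of ts "wgt s"]
      pair_number_less [of "max j (rank ts (wgt s))" "length ts" "tgt s"]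
    by (simp only: level_trans_sel)
next
  fix q a assume q: "q < Suc (length ts) * n" "a < card \<Sigma>"
  then have "q mod n < n" using initial_less by simp
  then obtain t where t: "t \<in> set ts" "src t = q mod n" "ltr t = a" using trans_exists q by blast
  have "q div n \<le> length ts" using q(1) by (simp add: less_mult_imp_div_less less_Suc_eq_le [symmetric])
  then have "lev W (q div n) t \<in> set (product_trans W [0..<n] ts)"
    unfolding set_product_trans using t by blast
  moreover have "src (lev W (q div n) t) = q" "ltr (lev W (q div n) t) = a"
    using t by (simp_all add: level_trans_sel)
  ultimately show "\<exists>t\<in>set (product_trans W [0..<n] ts). src t = q \<and> ltr t = a" by blast
next
  fix t t' assume "t \<in> set (product_trans W [0..<n] ts)" "t' \<in> set (product_trans W [0..<n] ts)"
    and eq: "src t = src t'" "ltr t = ltr t'"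
  then obtain j s j' s' where "s \<in> set ts" "t = lev W j s" "s' \<in> set ts" "t' = lev W j' s'"
    by (auto simp: set_product_trans)
  with level_trans_inj [of s s' W j j'] eq show "t = t'" by simp
qed

section \<open>The product automata and their runs\<close>

abbreviation "Product W \<equiv> aut_of f \<Sigma> (Suc (length ts) * n) i (product_trans W [0..<n] ts)"

lemma represents_product: "represents f (product_tree W [0..<card \<Sigma>] [0..<n] i ts) (Product W)"
  using numbered_automaton.represents_aut_tree [OF product_numbered [of W]]
  by (simp add: product_tree_def level_states_eq)

text \<open>As \<open>rank\<close> is monotone, this is the rank of the greatest among the first
  \<open>m\<close> weights.\<close>

fun level :: "(nat \<Rightarrow> rat) \<Rightarrow> nat \<Rightarrow> nat" where
  "level xs 0 = 0"
| "level xs (Suc m) = max (level xs m) (rank ts (xs m))"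

lemma level_le_length: "level xs m \<le> length ts"
  by (induction m) (simp_all add: rank_le_length)

lemma run_transition: "is_run Aut w qs xs \<Longrightarrow>
    \<exists>t\<in>set ts. src t = qs m \<and> ltr t = f (w m) \<and> wgt t = xs m \<and> tgt t = qs (Suc m)"
  by (rule bexI [of _ "(qs m, f (w m), xs m, qs (Suc m))"]) (auto simp: is_run_aut_of)

lemma run_weight: "is_run Aut w qs xs \<Longrightarrow> xs m \<in> wgt ` set ts"
  using run_transition by (metis imageI)

text \<open>Translates comparisons with the level back into comparisons of weights. For
  \<open>m = 0\<close> both sides fail, since weights have positive ranks.\<close>

lemma rank_le_level_iff:
  assumes "is_run Aut w qs xs" "t \<in> set ts"
  shows "rank ts (wgt t) \<le> level xs m \<longleftrightarrow> (\<exists>l<m. wgt t \<le> xs l)"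
proof (induction m)
  case 0
  then show ?case using rank_pos [OF assms(2)] by simp
next
  case (Suc m)
  then show ?case using rank_le_iff [OF assms(2), of "xs m"] by (auto simp: le_max_iff_disj less_Suc_eq)
qed

text \<open>The index \<open>Suc m\<close> is due to the fact that the weight of a step is
  determined by the level and the state after that step; this level already accounts for
  \<open>xs m\<close>.\<close>

abbreviation (input) "product_weight W qs xs m \<equiv> W [0..<n] ts (level xs (Suc m)) (qs (Suc m)) (xs m)"

lemma run_product:
  assumes "is_run Aut w qs xs"
  shows "is_run (Product W) w (\<lambda>m. level xs m * n + qs m) (product_weight W qs xs)"
  unfolding is_run_aut_of
proof (intro conjI allI)
  show "level xs 0 * n + qs 0 = i" using assms by (simp add: is_run_aut_of)
  fix m
  obtain t where t: "t \<in> set ts" "src t = qs m" "ltr t = f (w m)" "wgt t = xs m" "tgt t = qs (Suc m)"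
    using run_transition [OF assms, of m] by blast
  have "lev W (level xs m) t \<in> set (product_trans W [0..<n] ts)"
    unfolding set_product_trans using t(1) level_le_length by blast
  moreover have "lev W (level xs m) t = (level xs m * n + qs m, f (w m), product_weight W qs xs m,
      level xs (Suc m) * n + qs (Suc m))"
    using t by (simp add: level_trans_def)
  ultimately show "(level xs m * n + qs m, f (w m), product_weight W qs xs m,
      level xs (Suc m) * n + qs (Suc m)) \<in> set (product_trans W [0..<n] ts)" by simp
qed

lemma quantitative_product: "quantitative_automaton (Product W)"
  and deterministic_product: "deterministic (Product W)"
  using numbered_automaton.quantitative [OF product_numbered]
    numbered_automaton.deterministic [OF product_numbered] by blast+

lemma value_Aut:
  assumes "w \<in> omega_words \<Sigma>" "is_run Aut w qs xs"
  shows "aut_value Val Aut w = Val (\<lambda>m. of_rat (xs m))"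
  using aut_value_run [OF quantitative deterministic _ assms(2)] assms(1) by simp

lemma value_Product:
  assumes "w \<in> omega_words \<Sigma>" "is_run Aut w qs xs"
  shows "aut_value Val (Product W) w = Val (\<lambda>m. of_rat (product_weight W qs xs m))"
  using aut_value_run [OF quantitative_product deterministic_product _ run_product [OF assms(2)]]
    assms(1) by simp

lemma finite_product_weights:
  assumes "w \<in> omega_words \<Sigma>" "is_run Aut w qs xs"
  shows "finite (range (\<lambda>m. real_of_rat (product_weight W qs xs m)))"
  by (rule finite_run_weights [OF quantitative_product _ run_product [OF assms(2)]])
    (use assms(1) in simp)

section \<open>The safe and the live component\<close>

lemma fold_max_eq: "fold max xs (x :: rat) = Max (insert x (set xs))"
  using Max.set_eq_fold [of x xs] by simp

lemma set_reach_weights: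
  assumes "q < n"
  shows "set (reach_weights [0..<n] ts q) = {wgt t | t. t \<in> set ts \<and> (q, src t) \<in> (edges ts)\<^sup>*}"
proof -
  have "set (reach [0..<n] ts q) = {q'. (q, q') \<in> (edges ts)\<^sup>*}"
    by (rule set_reach) (use trans_less assms in blast)+
  then show ?thesis unfolding reach_weights_def set_map set_filter by blast
qed

lemma run_state_less: "w \<in> omega_words \<Sigma> \<Longrightarrow> is_run Aut w qs xs \<Longrightarrow> qs m < n"
  using run_state [OF quantitative, of w qs xs m] by simp

lemma run_reachable:
  assumes "is_run Aut w qs xs"
  shows "(qs m, qs (m + k)) \<in> (edges ts)\<^sup>*"
proof (induction k)
  case (Suc k)
  obtain t where "t \<in> set ts" "src t = qs (m + k)" "tgt t = qs (Suc (m + k))"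
    using run_transition [OF assms, of "m + k"] by blast
  then have "(qs (m + k), qs (m + Suc k)) \<in> edges ts"
    using imageI [of t "set ts" "\<lambda>t. (src t, tgt t)"] by (simp add: edges_def)
  with Suc show ?case by (rule rtrancl_into_rtrancl)
qed simp

section \<open>Weights of both components along a fixed run\<close>

context
  fixes w qs xs
  assumes w: "w \<in> omega_words \<Sigma>" and run: "is_run Aut w qs xs"
begin

text \<open>For \<open>l \<le> m\<close> the weight has been seen and is covered by the level;
  otherwise its transition is still reachable from the state after step \<open>m\<close>. So each
  weight of the safe component bounds the whole run from above.\<close>

lemma weight_le_safe_weight: "xs l \<le> product_weight safe_weight qs xs m"
proof -
  obtain t where t: "t \<in> set ts" "src t = qs l" "wgt t = xs l" using run_transition [OF run] by blast
  have "xs l \<in> set (filter (\<lambda>y. rank ts y \<le> level xs (Suc m)) (map wgt ts) @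
      reach_weights [0..<n] ts (qs (Suc m)))"
  proof (cases "l \<le> m")
    case True
    then have "\<exists>k<Suc m. wgt t \<le> xs k" by (intro exI [of _ l]) (simp add: t(3))
    then have "rank ts (wgt t) \<le> level xs (Suc m)" unfolding rank_le_level_iff [OF run t(1)] .
    then have "rank ts (xs l) \<le> level xs (Suc m)" unfolding t(3) .
    moreover have "xs l \<in> set (map wgt ts)" using run_weight [OF run] by simp
    ultimately show ?thesis by simp
  next
    case False
    then have "(qs (Suc m), src t) \<in> (edges ts)\<^sup>*"
      using run_reachable [OF run, of "Suc m" "l - Suc m"] t(2) by simp
    then have "xs l \<in> set (reach_weights [0..<n] ts (qs (Suc m)))"
      unfolding set_reach_weights [OF run_state_less [OF w run]]
      using t by (intro CollectI exI [of _ t]) simp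
    then show ?thesis by simp
  qed
  then show ?thesis unfolding safe_weight_def fold_max_eq by (intro Max_ge) auto
qed

text \<open>Under this premise every candidate for the maximum has a rank of at most the level, so
  some weight seen so far is at least as large.\<close>

lemma safe_weight_le:
  assumes "\<forall>y\<in>set (reach_weights [0..<n] ts (qs (Suc m))). rank ts y \<le> level xs (Suc m)"
  shows "\<exists>l. product_weight safe_weight qs xs m \<le> xs l"
proof -
  let ?ys = "filter (\<lambda>y. rank ts y \<le> level xs (Suc m)) (map wgt ts) @
      reach_weights [0..<n] ts (qs (Suc m))"
  have "Max (insert (xs m) (set ?ys)) \<in> insert (xs m) (set ?ys)" by (intro Max_in) auto
  then have mem: "product_weight safe_weight qs xs m \<in> insert (xs m) (set ?ys)"
    unfolding safe_weight_def fold_max_eq .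
  have ys: "\<exists>l. y \<le> xs l" if "y \<in> set ?ys" for y
  proof -
    have "y \<in> wgt ` set ts" using that by (auto simp: reach_weights_def)
    then obtain t where t: "t \<in> set ts" "y = wgt t" by blast
    have "rank ts (wgt t) \<le> level xs (Suc m)" using that assms t(2) by auto
    then show ?thesis unfolding rank_le_level_iff [OF run t(1)] t(2) by blast
  qed
  show ?thesis
  proof (cases "product_weight safe_weight qs xs m = xs m")
    case True
    then show ?thesis by (intro exI [of _ m]) simp
  next
    case False
    with mem show ?thesis by (intro ys) blast
  qed
qed

lemma live_weight_top:
  assumes "\<forall>y\<in>set (reach_weights [0..<n] ts (qs (Suc m))). rank ts y \<le> level xs (Suc m)"
  shows "product_weight live_weight qs xs m = Max (wgt ` set ts)"
proof -
  have "insert (xs m) (set (map wgt ts)) = wgt ` set ts" using run_weight [OF run, of m] by auto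
  then show ?thesis using assms unfolding live_weight_def fold_max_eq by simp
qed

lemma live_weight_not_top:
  assumes "\<not> (\<forall>y\<in>set (reach_weights [0..<n] ts (qs (Suc m))). rank ts y \<le> level xs (Suc m))"
  shows "product_weight live_weight qs xs m = xs m"
  unfolding live_weight_def using assms by (simp only: if_False)

lemma weight_le_Max: "xs m \<le> Max (wgt ` set ts)"
  using run_weight [OF run, of m] by (intro Max_ge) auto

lemma live_weight_bounds:
  shows weight_le_live_weight: "xs m \<le> product_weight live_weight qs xs m"
    and live_weight_le_Max: "product_weight live_weight qs xs m \<le> Max (wgt ` set ts)"
proof -
  have "product_weight live_weight qs xs m \<in> {xs m, Max (wgt ` set ts)}"
    using live_weight_top [of m] live_weight_not_top [of m] by blast
  then show "xs m \<le> product_weight live_weight qs xs m"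
    "product_weight live_weight qs xs m \<le> Max (wgt ` set ts)"
    using weight_le_Max [of m] by (elim insertE emptyE; simp only: order_refl)+
qed

lemma value_decomposition:
  "aut_value Sup_val Aut w =
     min (aut_value Inf_val (Product safe_weight) w) (aut_value Sup_val (Product live_weight) w)"
proof -
  let ?x = "\<lambda>m. real_of_rat (xs m)"
  let ?b = "\<lambda>m. real_of_rat (product_weight safe_weight qs xs m)"
  let ?c = "\<lambda>m. real_of_rat (product_weight live_weight qs xs m)"
  have x: "bdd_above (range ?x)"
    by (intro bdd_above_finite finite_run_weights [OF quantitative _ run]) (simp add: w)
  have b: "bdd_below (range ?b)" by (intro bdd_below_finite finite_product_weights [OF w run])
  have c: "bdd_above (range ?c)" by (intro bdd_above_finite finite_product_weights [OF w run])
  have x_le_b: "?x l \<le> ?b m" for l m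
    using weight_le_safe_weight [of l m] by (simp only: of_rat_less_eq)
  have x_le_c: "?x m \<le> ?c m" for m
    using weight_le_live_weight [of m] by (simp only: of_rat_less_eq)
  have "Sup (range ?x) \<le> Inf (range ?b)"
    by (rule cINF_greatest [OF UNIV_not_empty], rule cSUP_least [OF UNIV_not_empty], rule x_le_b)
  moreover have "Sup (range ?x) \<le> Sup (range ?c)"
    by (rule cSUP_mono [OF UNIV_not_empty c]) (use x_le_c in blast)
  moreover have "min (Inf (range ?b)) (Sup (range ?c)) \<le> Sup (range ?x)"
  proof (cases "\<exists>m. \<forall>y\<in>set (reach_weights [0..<n] ts (qs (Suc m))). rank ts y \<le> level xs (Suc m)")
    case True
    \<comment> \<open>A single weight of the safe component that is at most some weight of the run
      already forces its infimum below the value of the run.\<close>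
    then obtain m l where "product_weight safe_weight qs xs m \<le> xs l" using safe_weight_le by blast
    then have "?b m \<le> ?x l" by (simp only: of_rat_less_eq)
    moreover have "Inf (range ?b) \<le> ?b m" by (rule cINF_lower [OF b UNIV_I])
    moreover have "?x l \<le> Sup (range ?x)" by (rule cSUP_upper [OF UNIV_I x])
    ultimately show ?thesis by linarith
  next
    case False
    then have "product_weight live_weight qs xs m = xs m" for m
      using live_weight_not_top [of m] by blast
    then have "?c = ?x" by (simp only:)
    then show ?thesis by (simp only: min.cobounded2)
  qed
  ultimately show ?thesis
    unfolding value_Aut [OF w run] value_Product [OF w run] Inf_val_def Sup_val_def by linarith
qed

end

section \<open>Liveness of the second component\<close>

lemma run_obtain:
  assumes "w \<in> omega_words \<Sigma>"
  obtains qs xs where "is_run Aut w qs xs"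
  using run_exists [OF quantitative, of w] assms by auto

lemma value_live_le:
  assumes "w \<in> omega_words \<Sigma>"
  shows "aut_value Sup_val (Product live_weight) w \<le> of_rat (Max (wgt ` set ts))"
proof -
  obtain qs xs where run: "is_run Aut w qs xs" using run_obtain [OF assms] .
  show ?thesis
    unfolding value_Product [OF assms run] Sup_val_def
    by (rule cSUP_least [OF UNIV_not_empty])
      (unfold of_rat_less_eq, rule live_weight_le_Max [OF assms run])
qed

text \<open>After any prefix the greatest weight that is still reachable can be taken; from then on
  the level dominates everything reachable.\<close>

lemma value_live_attained:
  assumes w: "w \<in> omega_words \<Sigma>"
  obtains w' where "w' \<in> omega_words \<Sigma>"
    "aut_value Sup_val (Product live_weight) (prefix m w \<frown> w') \<ge> of_rat (Max (wgt ` set ts))"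
proof -
  obtain qs xs where run: "is_run Aut w qs xs" using run_obtain [OF w] .
  let ?Y = "\<lambda>q. {wgt t | t. t \<in> set ts \<and> (q, src t) \<in> (edges ts)\<^sup>*}"
  have fin: "finite (?Y q)" for q by (rule finite_subset [of _ "wgt ` set ts"]) (blast, simp)
  \<comment> \<open>The transition taken at step \<open>m\<close> shows that the maximum is taken
    over a nonempty set.\<close>
  have "xs m \<in> ?Y (qs m)" using run_transition [OF run, of m] by force
  then have "Max (?Y (qs m)) \<in> ?Y (qs m)" by (intro Max_in fin) blast
  then obtain t where t: "t \<in> set ts" "(qs m, src t) \<in> (edges ts)\<^sup>*" "wgt t = Max (?Y (qs m))" by auto
  obtain w' qs' xs' l where w': "w' \<in> omega_words \<Sigma>" "is_run Aut w' qs' xs'"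
    "\<And>i. i < m \<Longrightarrow> w' i = w i" "m \<le> l" "qs' l = src t" "xs' l = wgt t" "qs' (Suc l) = tgt t"
    by (rule run_through [OF w run t(2,1)]) (rule that)
  have "(qs m, tgt t) \<in> (edges ts)\<^sup>*"
    using t(2) by (rule rtrancl_into_rtrancl) (use t(1) in \<open>auto simp: edges_def\<close>)
  \<comment> \<open>Whatever is reachable after \<open>t\<close> was reachable before it, so it
    cannot exceed the maximum just taken.\<close>
  then have sub: "?Y (tgt t) \<subseteq> ?Y (qs m)" by (blast intro: rtrancl_trans)
  have "\<forall>y\<in>set (reach_weights [0..<n] ts (qs' (Suc l))). rank ts y \<le> level xs' (Suc l)"
  proof
    fix y assume "y \<in> set (reach_weights [0..<n] ts (qs' (Suc l)))"
    then have "y \<in> ?Y (qs' (Suc l))"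
      unfolding set_reach_weights [OF run_state_less [OF w'(1,2)]] .
    then have "y \<in> ?Y (tgt t)" unfolding w'(7) .
    then have "y \<le> xs' l" unfolding w'(6) t(3) using sub by (intro Max_ge fin) blast
    then have "rank ts y \<le> rank ts (xs' l)" by (rule rank_mono)
    then show "rank ts y \<le> level xs' (Suc l)" by simp
  qed
  then have "product_weight live_weight qs' xs' l = Max (wgt ` set ts)"
    by (rule live_weight_top [OF w'(1,2)])
  moreover have "real_of_rat (product_weight live_weight qs' xs' l) \<le>
      aut_value Sup_val (Product live_weight) w'"
    unfolding value_Product [OF w'(1,2)] Sup_val_def
    by (rule cSUP_upper [OF UNIV_I bdd_above_finite [OF finite_product_weights [OF w'(1,2)]]])
  moreover have "prefix m w \<frown> suffix m w' = w'"
  proof -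
    have "prefix m w = prefix m w'" using w'(3) by (auto simp: subsequence_def)
    then show ?thesis by simp
  qed
  moreover have "suffix m w' \<in> omega_words \<Sigma>" using w'(1) by (auto simp: omega_words_def)
  ultimately show ?thesis by (intro that [of "suffix m w'"]) simp_all
qed

text \<open>The greatest weight serves as \<open>v\<close> for all words: it bounds all values,
  hence also the top value, and every prefix has a continuation attaining it.\<close>

lemma live_Product: "live Sup_val (Product live_weight)"
  unfolding live_def aut_of_simps
proof (intro ballI impI)
  let ?C = "aut_value Sup_val (Product live_weight)" and ?top = "real_of_rat (Max (wgt ` set ts))"
  fix w assume w: "w \<in> omega_words \<Sigma>" and less: "?C w < top_value Sup_val (Product live_weight)"
  have "top_value Sup_val (Product live_weight) \<le> ?top"
    unfolding top_value_def aut_of_simps using w by (intro cSUP_least value_live_le) auto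
  with less have "?C w < ?top" by linarith
  moreover have "(SUP w'\<in>omega_words \<Sigma>. ?C (u \<frown> w')) \<ge> ?top" if "u \<prec> w" for u
  proof -
    obtain m where u: "u = prefix m w" using \<open>u \<prec> w\<close> by (auto simp: strict_prefix_of_def)
    obtain w' where w': "w' \<in> omega_words \<Sigma>" "?C (u \<frown> w') \<ge> ?top"
      using value_live_attained [OF w, of m] unfolding u by blast
    have "bdd_above ((\<lambda>w'. ?C (u \<frown> w')) ` omega_words \<Sigma>)"
      unfolding u by (intro bdd_aboveI2 [where M = ?top] value_live_le conc_in_omega_words w)
    then have "?C (u \<frown> w') \<le> (SUP w'\<in>omega_words \<Sigma>. ?C (u \<frown> w'))"
      using w'(1) by (intro cSUP_upper)
    with w'(2) show ?thesis by linarith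
  qed
  ultimately show "\<exists>v. ?C w < v \<and> (\<forall>u. u \<prec> w \<longrightarrow> (SUP w'\<in>omega_words \<Sigma>. ?C (u \<frown> w')) \<ge> v)"
    by blast
qed

end

section \<open>Numbering a given automaton\<close>

locale represented_automaton =
  fixes A :: "('a, 'q) automaton" and f :: "'a \<Rightarrow> nat" and g :: "'q \<Rightarrow> nat"
    and ts :: "('q \<times> 'a \<times> rat \<times> 'q) list"
  assumes A: "quantitative_automaton A" "deterministic A"
    and f: "bij_betw f (alphabet A) {..<card (alphabet A)}"
    and g: "bij_betw g (states A) {..<card (states A)}"
    and ts: "distinct ts" "set ts = transitions A"
begin

definition num :: "'q \<times> 'a \<times> rat \<times> 'q \<Rightarrow> ntrans" where
  "num = (\<lambda>(q, a, x, q'). (g q, f a, x, g q'))"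

lemma num_simp [simp]: "num (q, a, x, q') = (g q, f a, x, g q')"
  by (simp add: num_def)

lemma transition_states:
  "(q, a, x, q') \<in> transitions A \<Longrightarrow> q \<in> states A \<and> a \<in> alphabet A \<and> q' \<in> states A"
  using A(1) by (force simp: transitions_def quantitative_automaton_def)

lemma f_eq: "a \<in> alphabet A \<Longrightarrow> b \<in> alphabet A \<Longrightarrow> f a = f b \<longleftrightarrow> a = b"
  using f by (metis bij_betw_inv_into_left)

lemma g_eq: "p \<in> states A \<Longrightarrow> q \<in> states A \<Longrightarrow> g p = g q \<longleftrightarrow> p = q"
  using g by (metis bij_betw_inv_into_left)

lemma f_less: "a \<in> alphabet A \<Longrightarrow> f a < card (alphabet A)"
  using f by (auto simp: bij_betw_def)

lemma g_less: "q \<in> states A \<Longrightarrow> g q < card (states A)"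
  using g by (auto simp: bij_betw_def)

lemma transition_unique:
  assumes "(q, a, x, q') \<in> transitions A" "(q, a, y, p) \<in> transitions A"
  shows "x = y \<and> q' = p"
proof -
  have "is_singleton (delta A q a)" using assms(1) A(2) by (simp add: transitions_def deterministic_def)
  then show ?thesis using assms by (auto simp: transitions_def is_singleton_def)
qed

text \<open>Shows both that \<open>num\<close> is injective on the transitions and that determinism
  survives the numbering.\<close>

lemma num_determined:
  assumes "t \<in> transitions A" "t' \<in> transitions A" "src (num t) = src (num t')" "ltr (num t) = ltr (num t')"
  shows "t = t'"
proof -
  obtain q a x q' p b y p' where t: "t = (q, a, x, q')" "t' = (p, b, y, p')"
    by (metis prod_cases4)
  have "q \<in> states A" "p \<in> states A" "a \<in> alphabet A" "b \<in> alphabet A"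
    using transition_states assms(1,2) unfolding t by blast+
  moreover have "g q = g p" "f a = f b" using assms(3,4) by (simp_all add: t)
  ultimately have "q = p" "a = b" by (simp_all add: g_eq f_eq)
  then show ?thesis using transition_unique assms(1,2) unfolding t by blast
qed

lemma numbered: "numbered_automaton f (alphabet A) (card (states A)) (g (initial A)) (map num ts)"
proof
  show "finite (alphabet A)" using A(1) by (simp add: quantitative_automaton_def)
  show "bij_betw f (alphabet A) {..<card (alphabet A)}" by (rule f)
  show "g (initial A) < card (states A)" using A(1) by (intro g_less) (simp add: quantitative_automaton_def)
  have "inj_on num (set ts)"
    unfolding ts(2) by (rule inj_onI, rule num_determined) simp_all
  then show "distinct (map num ts)" using ts(1) by (simp add: distinct_map)
next
  fix t assume "t \<in> set (map num ts)"
  then obtain q a x q' where "(q, a, x, q') \<in> transitions A" "t = num (q, a, x, q')"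
    unfolding set_map ts(2) by (metis imageE prod_cases4)
  then show "src t < card (states A) \<and> ltr t < card (alphabet A) \<and> tgt t < card (states A)"
    using transition_states f_less g_less by simp
next
  fix p c assume "p < card (states A)" "c < card (alphabet A)"
  then have "p \<in> g ` states A" "c \<in> f ` alphabet A" using f g by (simp_all add: bij_betw_def)
  then obtain q a where qa: "q \<in> states A" "g q = p" "a \<in> alphabet A" "f a = c" by blast
  then have "delta A q a \<noteq> {}" using A(1) by (simp add: quantitative_automaton_def)
  then obtain x q' where "(x, q') \<in> delta A q a" by auto
  then have "(q, a, x, q') \<in> set ts" using qa by (simp add: ts(2) transitions_def)
  then have "num (q, a, x, q') \<in> set (map num ts)" unfolding set_map by (rule imageI)
  then show "\<exists>t\<in>set (map num ts). src t = p \<and> ltr t = c"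
    using qa by (intro bexI [of _ "num (q, a, x, q')"]) simp_all
next
  fix t t' assume t: "t \<in> set (map num ts)" "t' \<in> set (map num ts)" "src t = src t'" "ltr t = ltr t'"
  then obtain s s' where s: "s \<in> transitions A" "t = num s" "s' \<in> transitions A" "t' = num s'"
    unfolding set_map ts(2) by blast
  then have "s = s'" using t(3,4) by (intro num_determined) simp_all
  then show "t = t'" using s by simp
qed

sublocale numbered_automaton f "alphabet A" "card (states A)" "g (initial A)" "map num ts"
  by (rule numbered)

lemma aut_value_numbered:
  assumes "w \<in> omega_words (alphabet A)"
  shows "aut_value Val A w = aut_value Val Aut w"
proof -
  obtain qs xs where run: "is_run A w qs xs" using run_exists [OF A(1) assms] .
  have "is_run Aut w (\<lambda>m. g (qs m)) xs"
    unfolding is_run_aut_of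
  proof (intro conjI allI)
    show "g (qs 0) = g (initial A)" using run by (simp add: is_run_def)
    fix m
    have "w m \<in> alphabet A" using assms by (auto simp: omega_words_def)
    then have "(qs m, w m, xs m, qs (Suc m)) \<in> set ts"
      using run run_state [OF A(1) assms run, of m] by (simp add: ts(2) transitions_def is_run_def)
    then have "num (qs m, w m, xs m, qs (Suc m)) \<in> set (map num ts)" unfolding set_map by (rule imageI)
    then show "(g (qs m), f (w m), xs m, g (qs (Suc m))) \<in> set (map num ts)" by simp
  qed
  then show ?thesis
    using aut_value_run [OF A assms run] value_Aut [OF assms] by metis
qed

lemma enc_list_num: "enc_list (enc_trans f g) ts' = enc_list enc_ntrans (map num ts')"
  by (induction ts') (auto simp: enc_ntrans_def enc_trans_def)

text \<open>With \<open>N = aut_size A\<close>, three nodes join the parts, each of the two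
  intervals contributes at most \<open>N * (1 + 2 * N)\<close>, the initial state
  \<open>2 * N\<close> and the transitions \<open>N * (7 + 6 * N)\<close>. The sum is
  \<open>3 + 11 * N + 10 * N^2\<close>, so the coefficient 15 leaves some slack.\<close>

lemma size_aut_tree:
  "size (aut_tree [0..<card (alphabet A)] [0..<card (states A)] (g (initial A)) (map num ts))
    \<le> poly [:3, 15, 10:] (aut_size A)"
proof -
  define N where "N = aut_size A"
  have k: "card (alphabet A) \<le> N" and n: "card (states A) \<le> N"
    and "(\<Sum>(q, a, x, q')\<in>transitions A. 1 + rat_bitlen x) \<le> N"
    unfolding N_def aut_size_def by (intro Max_ge; simp)+
  moreover have "(\<Sum>t\<leftarrow>ts. 1 + rat_bitlen (wgt (num t))) = (\<Sum>t\<in>transitions A. 1 + rat_bitlen (wgt (num t)))"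
    using ts by (simp only: sum_list_distinct_conv_sum_set)
  moreover have "(\<lambda>t. 1 + rat_bitlen (wgt (num t))) = (\<lambda>(q, a, x, q'). 1 + rat_bitlen x)"
    by auto
  ultimately have bits: "(\<Sum>t\<leftarrow>ts. 1 + rat_bitlen (wgt (num t))) \<le> N" by (simp only:)
  have upt: "size (enc_list enc_nat [0..<j]) \<le> N * (1 + 2 * N)" if "j \<le> N" for j
  proof -
    have "size (enc_list enc_nat [0..<j]) \<le> (\<Sum>m\<leftarrow>[0..<j]. 1 + 2 * N)"
      unfolding size_enc_list
      by (rule sum_list_mono) (use that in \<open>auto intro!: size_enc_nat_le\<close>)
    also have "\<dots> = j * (1 + 2 * N)" by (simp add: sum_list_triv)
    also have "\<dots> \<le> N * (1 + 2 * N)" using that by (rule mult_le_mono1)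
    finally show ?thesis .
  qed
  have rat: "size (enc_rat x) \<le> 3 + 2 * rat_bitlen x" for x
    using size_enc_nat [of "nat \<bar>rat_num x\<bar>"] size_enc_nat [of "nat (rat_den x)"]
      size_enc_bool [of "rat_num x < 0"]
    by (simp add: enc_rat_eq rat_bitlen_def rat_num_def rat_den_def case_prod_unfold)
  have trans: "Suc (size (enc_ntrans (num t))) \<le> (1 + rat_bitlen (wgt (num t))) * (7 + 6 * N)"
    if "t \<in> set ts" for t
  proof -
    obtain q a x q' where t: "t = (q, a, x, q')" by (metis prod_cases4)
    have "q \<in> states A" "a \<in> alphabet A" "q' \<in> states A"
      using transition_states that unfolding t ts(2) by blast+
    then have "g q \<le> N" "f a \<le> N" "g q' \<le> N"
      using g_less f_less k n by (meson less_imp_le le_trans)+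
    then have "size (enc_nat (g q)) \<le> 2 * N" "size (enc_nat (f a)) \<le> 2 * N" "size (enc_nat (g q')) \<le> 2 * N"
      by (auto intro: size_enc_nat_le)
    then have "Suc (size (enc_ntrans (num t))) \<le> 7 + 6 * N + 2 * rat_bitlen x"
      using rat [of x] by (simp add: t enc_ntrans_def enc_trans_def)
    \<comment> \<open>As a product, the bound has a factor independent of the transition, which can
      be pulled out of the sum; the other factor is the summand in \<open>aut_size\<close>.\<close>
    also have "\<dots> \<le> (1 + rat_bitlen x) * (7 + 6 * N)" by simp
    finally show ?thesis by (simp add: t)
  qed
  have "size (enc_list enc_ntrans (map num ts)) = (\<Sum>t\<leftarrow>ts. Suc (size (enc_ntrans (num t))))"
    by (simp add: size_enc_list comp_def)
  also have "\<dots> \<le> (\<Sum>t\<leftarrow>ts. (1 + rat_bitlen (wgt (num t))) * (7 + 6 * N))"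
    by (rule sum_list_mono) (rule trans)
  also have "\<dots> = (\<Sum>t\<leftarrow>ts. 1 + rat_bitlen (wgt (num t))) * (7 + 6 * N)"
    by (rule sum_list_mult_const)
  also have "\<dots> \<le> N * (7 + 6 * N)" using bits by (rule mult_le_mono1)
  finally have "size (enc_list enc_ntrans (map num ts)) \<le> N * (7 + 6 * N)" .
  moreover have "g (initial A) \<le> N" using initial_less n by simp
  then have "size (enc_nat (g (initial A))) \<le> 2 * N" by (rule size_enc_nat_le)
  ultimately have "size (aut_tree [0..<card (alphabet A)] [0..<card (states A)] (g (initial A)) (map num ts))
      \<le> 3 + N * (1 + 2 * N) + N * (1 + 2 * N) + 2 * N + N * (7 + 6 * N)"
    using upt [OF k] upt [OF n] by (simp add: aut_tree_def)
  also have "\<dots> \<le> poly [:3, 15, 10:] N" by (simp add: algebra_simps)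
  finally show ?thesis unfolding N_def .
qed

end

theorem theorem9p3:
  shows "\<exists>(P :: prog) (p :: nat poly).
    \<forall>(A :: ('a, 'q) automaton) (f :: 'a \<Rightarrow> nat) (x :: tree).
      quantitative_automaton A \<and> deterministic A \<and> represents f x A \<longrightarrow>
      (\<exists>y z t (B :: ('a, nat) automaton) (C :: ('a, nat) automaton).
         computes_in P x (Node y z) t \<and> t \<le> poly p (aut_size A) \<and>
         represents f y B \<and> represents f z C \<and>
         quantitative_automaton B \<and> alphabet B = alphabet A \<and>
         deterministic B \<and> safe Inf_val B \<and>
         quantitative_automaton C \<and> alphabet C = alphabet A \<and>
         deterministic C \<and> live Sup_val C \<and>
         (\<forall>w\<in>omega_words (alphabet A).
            aut_value Sup_val A w = min (aut_value Inf_val B w) (aut_value Sup_val C w)))"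
proof -
  obtain P p where prog: "\<And>ls qs i ts. \<exists>t\<le>poly p (size (aut_tree ls qs i ts)).
    computes_in P (aut_tree ls qs i ts)
      (Node (product_tree safe_weight ls qs i ts) (product_tree live_weight ls qs i ts)) t"
    by (rule product_program) (rule that)
  show ?thesis
  \<comment> \<open>The program is polynomial in the size of the input tree; the inner polynomial
    converts this into a bound in \<open>aut_size A\<close>.\<close>
  proof (rule exI [of _ P], rule exI [of _ "pcompose p [:3, 15, 10:]"], intro allI impI, elim conjE)
    fix A :: "('a, 'q) automaton" and f :: "'a \<Rightarrow> nat" and x :: tree
    assume A: "quantitative_automaton A" "deterministic A" and rep: "represents f x A"
    from rep obtain g ts where f: "bij_betw f (alphabet A) {..<card (alphabet A)}"
      and g: "bij_betw g (states A) {..<card (states A)}"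
      and ts: "distinct ts" "set ts = transitions A"
      and x: "x = Node (enc_list enc_nat [0..<card (alphabet A)])
              (Node (enc_list enc_nat [0..<card (states A)])
                (Node (enc_nat (g (initial A)))
                  (enc_list (enc_trans f g) ts)))"
      unfolding represents_def by blast
    interpret represented_automaton A f g ts
      by unfold_locales (fact A f g ts)+
    let ?k = "card (alphabet A)" and ?n = "card (states A)"
    have x: "x = aut_tree [0..<?k] [0..<?n] (g (initial A)) (map num ts)"
      by (simp add: x aut_tree_def enc_list_num)
    obtain t where t: "t \<le> poly p (size x)" "computes_in P x
        (Node (product_tree safe_weight [0..<?k] [0..<?n] (g (initial A)) (map num ts))
          (product_tree live_weight [0..<?k] [0..<?n] (g (initial A)) (map num ts))) t"
      using prog [of "[0..<?k]" "[0..<?n]" "g (initial A)" "map num ts"] unfolding x by blast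
    note t(1)
    also have "poly p (size x) \<le> poly (pcompose p [:3, 15, 10:]) (aut_size A)"
      unfolding poly_pcompose x by (rule poly_nat_mono [OF size_aut_tree])
    finally have time: "t \<le> poly (pcompose p [:3, 15, 10:]) (aut_size A)" .
    have decomposition: "aut_value Sup_val A w =
        min (aut_value Inf_val (Product safe_weight) w) (aut_value Sup_val (Product live_weight) w)"
      if w: "w \<in> omega_words (alphabet A)" for w
    proof -
      obtain qs xs where "is_run Aut w qs xs" by (rule run_obtain [OF w]) (rule that)
      then show ?thesis using value_decomposition [OF w] aut_value_numbered [OF w] by metis
    qed
    show "\<exists>y z t (B :: ('a, nat) automaton) (C :: ('a, nat) automaton).
         computes_in P x (Node y z) t \<and> t \<le> poly (pcompose p [:3, 15, 10:]) (aut_size A) \<and>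
         represents f y B \<and> represents f z C \<and>
         quantitative_automaton B \<and> alphabet B = alphabet A \<and>
         deterministic B \<and> safe Inf_val B \<and>
         quantitative_automaton C \<and> alphabet C = alphabet A \<and>
         deterministic C \<and> live Sup_val C \<and>
         (\<forall>w\<in>omega_words (alphabet A).
            aut_value Sup_val A w = min (aut_value Inf_val B w) (aut_value Sup_val C w))"
      by (intro exI conjI ballI, rule t(2), rule time, rule represents_product,
          rule represents_product, rule quantitative_product, rule aut_of_simps,
          rule deterministic_product, rule safe_Inf [OF quantitative_product deterministic_product],
          rule quantitative_product, rule aut_of_simps, rule deterministic_product,
          rule live_Product, rule decomposition)
  qed
qed

end
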